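(* Let $\mathbf{m}=(a,b,c,d,e,f)=(m_{01},m_{02},m_{03},m_{12},m_{13},m_{23})$ be a multiplicity on the $A_3$ arrangement, with all entries positive integers. The multiplicity $\mathbf{m}$ is free if and only if the syzygies on the ideal $J(0123)$ are generated by the syzygies on the four sub-ideals $J(012)$, $J(013)$, $J(023)$, $J(123)$. Explicitly, with $x=x_1-x_0$, $y=x_2-x_0$, $z=x_3-x_0$, the multiplicity $\mathbf{m}$ is free if and only if the syzygies on $$\langle x^a,\;y^b,\;z^c,\;(y-x)^d,\;(z-x)^e,\;(z-y)^f\rangle$$ are generated by the syzygies on the four sub-ideals $$\langle x^a,y^b,(y-x)^d\rangle,\quad \langle x^a,z^c,(z-x)^e\rangle,\quad \langle y^b,z^c,(z-y)^f\rangle,\quad \langle (z-y)^f,(z-x)^e,(y-x)^d\rangle .$$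
   Context: Let $\mathbb{K}$ be a field of characteristic zero and $S=\mathbb{K}[x_0,x_1,x_2,x_3]$. The $A_3$ arrangement consists of the hyperplanes $H_{ij}=V(x_i-x_j)$, $0\le i<j\le3$, corresponding to the edges of the complete graph $K_4$ on vertices $0,1,2,3$. For a multiplicity $\mathbf{m}=(m_{ij})$ put $$D(A_3,\mathbf{m})=\{\theta\in \bigoplus_{i=0}^3 S\,\partial_{x_i} : \theta(x_i-x_j)\in\langle (x_i-x_j)^{m_{ij}}\rangle \text{ for all } 0\le i<j\le 3\};$$ $\mathbf{m}$ is free if $D(A_3,\mathbf{m})$ is a free $S$-module. For $\sigma\subset\{0,1,2,3\}$, $J(\sigma)=\langle (x_i-x_j)^{m_{ij}}: \{i,j\}\subset\sigma\rangle$. Syzygies are always taken among the listed generators, even if these are not a minimal generating set: inside the free module with basis $[e_{ij}]$, $0\le i<j\le3$, the syzygy module of $J(0123)$ is $\{\sum_{i<j} g_{ij}[e_{ij}] : \sum g_{ij}\alpha_{ij}=0\}$, where $\alpha_{ij}$ denotes the listed generator corresponding to the edge $\{i,j\}$ ($\alpha_{01}=x^a$, $\alpha_{02}=y^b$, $\alpha_{03}=z^c$, $\alpha_{12}=(y-x)^d$, $\alpha_{13}=(z-x)^e$, $\alpha_{23}=(z-y)^f$). The syzygies on $J(ijk)$ are those elements whose coefficients vanish outside the three edges of the triangle $\{i,j,k\}$. "Generated by" means that the syzygy module of $J(0123)$ equals the sum of these four submodules. *)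

theory Defs
  imports
    "HOL-Analysis.Cartesian_Space"
    "HOL-Library.Poly_Mapping"
    "HOL-Library.Set_Algebras"
begin

section \<open>The polynomial ring in four variables\<close>

text \<open>
  \<open>'k S\<close> is the polynomial ring $k[x_0,x_1,x_2,x_3]$: finitely supported functions from exponent
  vectors to coefficients, with convolution as multiplication. The variables, and the vertices of
  $K_4$, are indexed by the four elements \<open>0 < 1 < 2 < 3\<close> of the type \<open>4\<close>; only the set
  and its linear order matter, the arithmetic of the type \<open>4\<close> is not used.
\<close>

type_synonym 'k S = "(4 \<Rightarrow>\<^sub>0 nat) \<Rightarrow>\<^sub>0 'k"

definition X :: "4 \<Rightarrow> 'k::field_char_0 S"
  where "X i = Poly_Mapping.single (Poly_Mapping.single i 1) 1"

definition partial_deriv :: "4 \<Rightarrow> 'k::field_char_0 S \<Rightarrow> 'k S"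
  where "partial_deriv i p =
    (\<Sum>u\<in>Poly_Mapping.keys p.
      Poly_Mapping.single (u - Poly_Mapping.single i 1)
        (of_nat (Poly_Mapping.lookup u i) * Poly_Mapping.lookup p u))"

definition ideal_gen :: "'k::field_char_0 S set \<Rightarrow> 'k S set"
  where "ideal_gen G = module.span (*) G"


section \<open>Multi-derivations of the braid arrangement\<close>

text \<open>A vector \<open>\<theta> :: 'k S ^ 4\<close> stands for the derivation $\sum_k \theta_k \partial_{x_k}$.\<close>

definition apply_der :: "'k::field_char_0 S ^ 4 \<Rightarrow> 'k S \<Rightarrow> 'k S"
  where "apply_der \<theta> p = (\<Sum>k\<in>UNIV. \<theta> $ k * partial_deriv k p)"

definition edges :: "4 set \<Rightarrow> (4 \<times> 4) set"
  where "edges \<sigma> = {(i, j). i \<in> \<sigma> \<and> j \<in> \<sigma> \<and> i < j}"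

text \<open>
  A family indexed by the six edges is a function on pairs; its values at pairs \<open>(i, j)\<close> with
  \<open>\<not> i < j\<close> are never used.
\<close>

definition edge_family :: "'a::zero \<Rightarrow> 'a \<Rightarrow> 'a \<Rightarrow> 'a \<Rightarrow> 'a \<Rightarrow> 'a \<Rightarrow> 4 \<times> 4 \<Rightarrow> 'a"
  where "edge_family u01 u02 u03 u12 u13 u23 =
    (\<lambda>_. 0)((0,1) := u01, (0,2) := u02, (0,3) := u03, (1,2) := u12, (1,3) := u13, (2,3) := u23)"

definition D_A3 :: "(4 \<times> 4 \<Rightarrow> nat) \<Rightarrow> ('k::field_char_0 S ^ 4) set"
  where "D_A3 m =
    {\<theta>. \<forall>(i, j)\<in>edges UNIV. apply_der \<theta> (X i - X j) \<in> ideal_gen {(X i - X j) ^ m (i, j)}}"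

definition free_submodule :: "('k::field_char_0 S ^ 'n) set \<Rightarrow> bool"
  where "free_submodule M \<longleftrightarrow>
    (\<exists>B. \<not> module.dependent (*s) B \<and> module.span (*s) B = M)"


section \<open>Syzygies\<close>

text \<open>
  The free module with basis $[e_{ij}]$, $i<j$, is realised as the vectors in \<open>'k S ^ (4 \<times> 4)\<close>
  that vanish outside \<open>edges UNIV\<close>. Correspondingly, \<open>syzygies \<alpha> \<sigma>\<close> consists of the syzygies on
  the generators \<open>\<alpha> (i, j)\<close> with \<open>i < j\<close> in \<open>\<sigma>\<close>, extended by zero to all edges.
\<close>

definition syzygies :: "(4 \<times> 4 \<Rightarrow> 'k::field_char_0 S) \<Rightarrow> 4 set \<Rightarrow> ('k S ^ (4 \<times> 4)) set"
  where "syzygies \<alpha> \<sigma> =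
    {g. (\<forall>p. p \<notin> edges \<sigma> \<longrightarrow> g $ p = 0) \<and> (\<Sum>p\<in>edges \<sigma>. g $ p * \<alpha> p) = 0}"

text \<open>The \<open>+\<close> on the right-hand side is the elementwise sum of sets from \<open>Set_Algebras\<close>.\<close>

definition syzygies_generated_by_triangles :: "(4 \<times> 4 \<Rightarrow> 'k::field_char_0 S) \<Rightarrow> bool"
  where "syzygies_generated_by_triangles \<alpha> \<longleftrightarrow>
    syzygies \<alpha> {0,1,2,3} =
      syzygies \<alpha> {0,1,2} + syzygies \<alpha> {0,1,3} + syzygies \<alpha> {0,2,3} + syzygies \<alpha> {1,2,3}"


section \<open>Basic facts\<close>

lemma module_S: "module ((*) :: 'k::field_char_0 S \<Rightarrow> _)"
  by standard (simp_all add: algebra_simps)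

lemma module_S_vec: "module ((*s) :: 'k::field_char_0 S \<Rightarrow> 'k S ^ 'n \<Rightarrow> _)"
  by standard (simp_all add: vec_eq_iff algebra_simps)

lemma ideal_gen_singleton: "p \<in> ideal_gen {q} \<longleftrightarrow> q dvd p"
  unfolding ideal_gen_def module.span_singleton[OF module_S]
  by (auto simp: dvd_def mult.commute)

lemma UNIV_A3: "(UNIV :: 4 set) = {0,1,2,3}"
  using UNIV_4 by auto

lemma edges_all: "edges UNIV = {(0,1),(0,2),(0,3),(1,2),(1,3),(2,3)}"
  unfolding edges_def UNIV_A3
  by (auto simp: less_bit0_def bit0.Rep_numeral bit0.Rep_0 bit0.Rep_1)

lemma edge_family_simps [simp]:
  "edge_family u01 u02 u03 u12 u13 u23 (0,1) = u01"
  "edge_family u01 u02 u03 u12 u13 u23 (0,2) = u02"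
  "edge_family u01 u02 u03 u12 u13 u23 (0,3) = u03"
  "edge_family u01 u02 u03 u12 u13 u23 (1,2) = u12"
  "edge_family u01 u02 u03 u12 u13 u23 (1,3) = u13"
  "edge_family u01 u02 u03 u12 u13 u23 (2,3) = u23"
  by (simp_all add: edge_family_def)

lemma partial_deriv_diff: "partial_deriv i (p - q) = partial_deriv i p - partial_deriv i q"
proof -
  let ?t = "\<lambda>p u. Poly_Mapping.single (u - Poly_Mapping.single i 1)
        (of_nat (Poly_Mapping.lookup u i) * Poly_Mapping.lookup p u)"
  let ?A = "Poly_Mapping.keys p \<union> Poly_Mapping.keys q"
  have ext: "partial_deriv i r = (\<Sum>u\<in>?A. ?t r u)" if "Poly_Mapping.keys r \<subseteq> ?A" for r
    unfolding partial_deriv_def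
    by (rule sum.mono_neutral_left) (use that in \<open>auto simp: in_keys_iff\<close>)
  have "Poly_Mapping.keys (p - q) \<subseteq> ?A" by (rule keys_diff)
  then show ?thesis
    by (simp add: ext lookup_minus single_diff right_diff_distrib sum_subtractf)
qed

lemma partial_deriv_X: "partial_deriv i (X j) = (if i = j then 1 else 0)"
  by (auto simp: partial_deriv_def X_def lookup_single)

lemma apply_der_X_diff: "apply_der \<theta> (X i - X j) = \<theta> $ i - \<theta> $ j"
proof -
  have "apply_der \<theta> (X i - X j) =
      (\<Sum>k\<in>UNIV. (if k = i then \<theta> $ k else 0) - (if k = j then \<theta> $ k else 0))"
    unfolding apply_der_def partial_deriv_diff partial_deriv_X
    by (rule sum.cong) (simp_all add: right_diff_distrib)
  then show ?thesis
    by (simp add: sum_subtractf)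
qed

end

(*
  D(A_3,m) is graded, so it is free over S if and only if it has depth 4, that is, if and only if
  X 0, x, y, z is a regular sequence on it.  Only the last step can fail: z must be a nonzerodivisor
  modulo (x, y).  Dividing theta_i - theta_j by alpha_ij identifies D(A_3,m), up to the constant
  derivation, with the kernel E of the map from the direct sum of the four triangle syzygy modules
  N_k to the syzygy module Z of J(0123); let Q be its image.  Each N_k has depth 3 over K[x,y,z]
  because its generators involve only three of the four variables.  So the condition on E says
  that Q has depth at least 2, i.e. that x s, y s, z s in Q implies s in Q, both directions being a
  Koszul diagram chase.  Z has this property, and Koszul syzygies show that powers of x, y and z
  kill Z/Q, so the condition is equivalent to Q = Z.
*)
theory Submission
  imports Defs
begin


section \<open>Polynomials\<close>

text \<open>Reduction modulo a linear form is modelled by a substitution that is congruent to the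
  identity modulo that form and maps the module into itself. \<open>translate\<close> does this for
  X 0; for triangle syzygies, equating the variable of the omitted vertex with another variable does
  it for their difference. Everything thus stays inside \<open>S\<close>. The kernel consists of
  derivations because every edge of K_4 lies in exactly two triangles: a family of triangle syzygies
  with sum zero is, up to sign, one coefficient per edge, and this coefficient times alpha_ij is
  theta_i - theta_j. Z is saturated because \<open>S\<close> is a domain: a syzygy condition on x s
  can be divided by x. The Koszul syzygy of two edges in a common triangle lies in Q. The others
  belong to pairs of opposite edges, and the generator of any edge that meets both multiplies them
  into Q. Each of x, y and z is a sum of two such edge forms, up to sign, so the binomial theorem
  gives the required powers.\<close>

lemma poly_mapping_induct_single [case_names single add]:
  fixes p :: "'a \<Rightarrow>\<^sub>0 'b::comm_monoid_add"
  assumes single: "\<And>u c. P (Poly_Mapping.single u c)"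
    and add: "\<And>p q. P p \<Longrightarrow> P q \<Longrightarrow> P (p + q)"
  shows "P p"
proof -
  have P_sum: "P (\<Sum>u\<in>A. Poly_Mapping.single u (Poly_Mapping.lookup p u))" if "finite A" for A
    using that
  proof (induction A)
    case empty
    then show ?case using single[of undefined 0] by simp
  qed (simp add: single add)
  have "p = (\<Sum>u\<in>Poly_Mapping.keys p. Poly_Mapping.single u (Poly_Mapping.lookup p u))"
    by (rule poly_mapping_eqI) (auto simp: lookup_sum lookup_single when_def in_keys_iff)
  then show ?thesis
    using P_sum[OF finite_keys] by metis
qed

section \<open>Substitution endomorphisms\<close>

definition Const :: "'k::field_char_0 \<Rightarrow> 'k S"
  where "Const c = Poly_Mapping.single 0 c"

definition subst :: "(4 \<Rightarrow> 'k S) \<Rightarrow> 'k::field_char_0 S \<Rightarrow> 'k S"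
  where "subst s p = (\<Sum>u\<in>Poly_Mapping.keys p.
    Const (Poly_Mapping.lookup p u) * (\<Prod>i\<in>UNIV. s i ^ Poly_Mapping.lookup u i))"

lemma Const_simps:
  "Const 0 = 0" "Const 1 = 1" "Const (c + d) = Const c + Const d" "Const (c * d) = Const c * Const d"
  by (simp_all add: Const_def single_add mult_single)

lemma subst_superset:
  assumes "finite A" "Poly_Mapping.keys p \<subseteq> A"
  shows "subst s p = (\<Sum>u\<in>A. Const (Poly_Mapping.lookup p u) * (\<Prod>i\<in>UNIV. s i ^ Poly_Mapping.lookup u i))"
  unfolding subst_def
  by (rule sum.mono_neutral_left) (use assms in \<open>auto simp: in_keys_iff Const_simps\<close>)

lemma subst_add: "subst s (p + q) = subst s p + subst s q"
proof -
  let ?A = "Poly_Mapping.keys p \<union> Poly_Mapping.keys q"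
  have "Poly_Mapping.keys (p + q) \<subseteq> ?A" by (rule keys_add)
  then show ?thesis
    by (simp add: subst_superset[of ?A] lookup_add Const_simps distrib_right sum.distrib)
qed

lemma subst_single:
  "subst s (Poly_Mapping.single u c) = Const c * (\<Prod>i\<in>UNIV. s i ^ Poly_Mapping.lookup u i)"
  by (subst subst_superset[of "{u}"]) auto

lemma subst_mult: "subst s (p * q) = subst s p * subst s q"
proof (induction p rule: poly_mapping_induct_single)
  case (single u c)
  show ?case
  proof (induction q rule: poly_mapping_induct_single)
    case (single v d)
    show ?case
      by (simp add: mult_single subst_single Const_simps lookup_add power_add prod.distrib)
  qed (simp add: subst_add distrib_left)
qed (simp add: subst_add distrib_right)

lemma subst_zero [simp]: "subst s 0 = 0"
  by (simp add: subst_def)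

lemma subst_one [simp]: "subst s 1 = 1"
  using subst_single[of s 0 1] by (simp add: Const_simps)

lemma subst_Const [simp]: "subst s (Const c) = Const c"
  by (simp add: Const_def subst_single)

lemma subst_uminus: "subst s (- p) = - subst s p"
  using subst_add[of s p "- p"] by (simp add: eq_neg_iff_add_eq_0 add.commute)

lemma subst_diff: "subst s (p - q) = subst s p - subst s q"
  using subst_add[of s p "- q"] by (simp add: subst_uminus)

lemma subst_power: "subst s (p ^ n) = subst s p ^ n"
  by (induction n) (simp_all add: subst_mult)

lemma subst_sum: "subst s (sum f A) = (\<Sum>a\<in>A. subst s (f a))"
  by (induction A rule: infinite_finite_induct) (simp_all add: subst_add)

lemma subst_X [simp]: "subst s (X i) = s i"
proof -
  have "subst s (X i) = (\<Prod>j\<in>UNIV. s j ^ (if i = j then 1 else 0))"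
    by (simp add: X_def subst_single lookup_single when_def Const_simps del: One_nat_def)
  also have "\<dots> = (\<Prod>j\<in>UNIV. if i = j then s j else 1)"
    by (rule prod.cong) auto
  finally show ?thesis by simp
qed

lemmas subst_simps = subst_add subst_mult subst_uminus subst_diff subst_power subst_sum

lemma X_power: "X i ^ n = Poly_Mapping.single (Poly_Mapping.single i n) 1"
  by (induction n) (simp_all add: X_def mult_single single_add[symmetric] Const_simps[unfolded Const_def])

lemma single_conv_X:
  fixes c :: "'k::field_char_0"
  shows "Poly_Mapping.single u c = Const c * (\<Prod>i\<in>UNIV. X i ^ Poly_Mapping.lookup u i)"
proof -
  have "(\<Prod>i\<in>A. X i ^ Poly_Mapping.lookup u i)
      = Poly_Mapping.single (\<Sum>i\<in>A. Poly_Mapping.single i (Poly_Mapping.lookup u i)) (1::'k)"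
    if "finite A" for A :: "4 set"
    using that by (induction A) (simp_all add: X_power mult_single)
  moreover have "(\<Sum>i\<in>UNIV. Poly_Mapping.single i (Poly_Mapping.lookup u i)) = u"
    by (rule poly_mapping_eqI) (simp add: lookup_sum lookup_single when_def)
  ultimately show ?thesis
    by (simp add: Const_def mult_single)
qed

lemma S_induct [case_names Const X add mult]:
  fixes p :: "'k::field_char_0 S"
  assumes Const: "\<And>c. P (Const c)" and X: "\<And>i. P (X i)"
    and add: "\<And>p q. P p \<Longrightarrow> P q \<Longrightarrow> P (p + q)" and mult: "\<And>p q. P p \<Longrightarrow> P q \<Longrightarrow> P (p * q)"
  shows "P p"
proof (induction p rule: poly_mapping_induct_single)
  case (single u c)
  have P1: "P 1" using Const[of 1] by (simp add: Const_simps)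
  then have pow: "P (X i ^ n)" for i n
    by (induction n) (simp_all add: mult X)
  have "P (\<Prod>i\<in>A. X i ^ Poly_Mapping.lookup u i)" if "finite A" for A
    using that by (induction A) (simp_all add: mult P1 pow)
  then show ?case unfolding single_conv_X by (simp add: mult Const)
qed (rule add)

text \<open>Modulo \<open>l\<close>, \<open>subst s\<close> and the identity are ring maps that
  agree on constants and variables. This lets \<open>subst s\<close> stand in for the quotient
  map.\<close>

lemma dvd_diff_subst:
  assumes "\<And>i. l dvd X i - s i"
  shows "l dvd p - subst s p"
proof (induction p rule: S_induct)
  case (add p q)
  then have "l dvd (p - subst s p) + (q - subst s q)" by (rule dvd_add)
  then show ?case by (simp add: subst_add algebra_simps)
next
  case (mult p q)
  then have "l dvd (p - subst s p) * q + subst s p * (q - subst s q)" by simp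
  then show ?case by (simp add: subst_mult algebra_simps)
qed (use assms in simp_all)


section \<open>Homogeneous components\<close>

definition mdeg :: "(4 \<Rightarrow>\<^sub>0 nat) \<Rightarrow> nat"
  where "mdeg u = (\<Sum>i\<in>UNIV. Poly_Mapping.lookup u i)"

definition hcomp :: "nat \<Rightarrow> 'k::field_char_0 S \<Rightarrow> 'k S"
  where "hcomp n p = Poly_Mapping.mapp (\<lambda>u c. c when mdeg u = n) p"

definition homogeneous :: "nat \<Rightarrow> 'k::field_char_0 S \<Rightarrow> bool"
  where "homogeneous n p \<longleftrightarrow> hcomp n p = p"

lemma mdeg_add: "mdeg (u + v) = mdeg u + mdeg v"
  by (simp add: mdeg_def lookup_add sum.distrib)

lemma mdeg_zero [simp]: "mdeg 0 = 0"
  by (simp add: mdeg_def)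

lemma lookup_hcomp:
  "Poly_Mapping.lookup (hcomp n p) u = (Poly_Mapping.lookup p u when mdeg u = n)"
  by (auto simp: hcomp_def lookup_mapp when_def in_keys_iff)

lemma hcomp_zero [simp]: "hcomp n 0 = 0"
  by (rule poly_mapping_eqI) (simp add: lookup_hcomp)

lemma hcomp_add: "hcomp n (p + q) = hcomp n p + hcomp n q"
  by (rule poly_mapping_eqI) (simp add: lookup_hcomp lookup_add when_def)

lemma hcomp_diff: "hcomp n (p - q) = hcomp n p - hcomp n q"
  by (rule poly_mapping_eqI) (simp add: lookup_hcomp lookup_minus when_def)

lemma hcomp_hcomp: "hcomp n (hcomp k p) = (if n = k then hcomp n p else 0)"
  by (rule poly_mapping_eqI) (auto simp: lookup_hcomp when_def)

lemma hcomp_single: "hcomp n (Poly_Mapping.single u c) = (if mdeg u = n then Poly_Mapping.single u c else 0)"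
  by (rule poly_mapping_eqI) (auto simp: lookup_hcomp lookup_single when_def)

lemma hcomp_single_mult:
  "hcomp n (Poly_Mapping.single u c * q)
    = (if mdeg u \<le> n then Poly_Mapping.single u c * hcomp (n - mdeg u) q else 0)"
  by (induction q rule: poly_mapping_induct_single)
    (auto simp: mult_single hcomp_single mdeg_add hcomp_add distrib_left)

lemma hcomp_homogeneous_mult:
  assumes "homogeneous m p"
  shows "hcomp n (p * q) = (if m \<le> n then p * hcomp (n - m) q else 0)"
proof -
  \<comment> \<open>A homogeneous \<open>p\<close> has the form \<open>hcomp m r\<close>, and in
    this form the induction can run over arbitrary polynomials \<open>r\<close>.\<close>
  have "hcomp n (hcomp m r * q) = (if m \<le> n then hcomp m r * hcomp (n - m) q else 0)" for r
    by (induction r rule: poly_mapping_induct_single)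
      (auto simp: hcomp_single hcomp_single_mult hcomp_add distrib_right)
  then show ?thesis using assms unfolding homogeneous_def by metis
qed

lemma homogeneous_X: "homogeneous 1 (X i)"
  by (simp add: homogeneous_def X_def hcomp_single mdeg_def lookup_single when_def)

lemma homogeneous_diff: "homogeneous n p \<Longrightarrow> homogeneous n q \<Longrightarrow> homogeneous n (p - q)"
  by (simp add: homogeneous_def hcomp_diff)

lemma homogeneous_mult: "homogeneous m p \<Longrightarrow> homogeneous n q \<Longrightarrow> homogeneous (m + n) (p * q)"
  by (simp add: homogeneous_def[of "m + n"] hcomp_homogeneous_mult) (simp add: homogeneous_def)

lemma homogeneous_one: "homogeneous 0 1"
  using hcomp_single[of 0 0 1] by (simp add: homogeneous_def)

lemma homogeneous_power: "homogeneous m p \<Longrightarrow> homogeneous (n * m) (p ^ n)"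
  by (induction n) (simp_all add: homogeneous_one homogeneous_mult)

lemma homogeneous_Const: "homogeneous 0 (Const c)"
  by (simp add: homogeneous_def Const_def hcomp_single)

lemma hcomp_bound: "\<exists>N. \<forall>n\<ge>N. hcomp n p = 0"
proof -
  have "hcomp n p = 0" if "n > (\<Sum>u\<in>Poly_Mapping.keys p. mdeg u)" for n
  proof (rule poly_mapping_eqI)
    fix u
    show "Poly_Mapping.lookup (hcomp n p) u = Poly_Mapping.lookup 0 u"
    proof (cases "u \<in> Poly_Mapping.keys p")
      case True
      then have "mdeg u \<le> (\<Sum>u\<in>Poly_Mapping.keys p. mdeg u)"
        by (simp add: member_le_sum)
      then show ?thesis using that by (simp add: lookup_hcomp)
    qed (simp add: lookup_hcomp in_keys_iff)
  qed
  then show ?thesis by (meson less_eq_Suc_le)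
qed

lemma sum_hcomp:
  assumes "\<forall>n\<ge>N. hcomp n p = 0"
  shows "(\<Sum>n<N. hcomp n p) = p"
proof (rule poly_mapping_eqI)
  fix u
  have "Poly_Mapping.lookup p u = 0" if "mdeg u \<ge> N"
    using assms that lookup_hcomp[of "mdeg u" p u] by simp
  then show "Poly_Mapping.lookup (\<Sum>n<N. hcomp n p) u = Poly_Mapping.lookup p u"
    by (auto simp: lookup_sum lookup_hcomp when_def not_less)
qed


section \<open>A graded depth criterion for freeness\<close>

interpretation svec: module "(*s) :: 'k::field_char_0 S \<Rightarrow> 'k S ^ 'n \<Rightarrow> _"
  by (rule module_S_vec)

text \<open>A basis of \<open>M\<close> modulo the ideal is chosen over the constants first, and
  then shown to be a basis over \<open>S\<close>.\<close>

interpretation kvec: vector_space "\<lambda>c. (*s) (Const c) :: 'k::field_char_0 S ^ 'n \<Rightarrow> _"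
  by standard (simp_all add: Const_simps svec.scale_right_distrib svec.scale_left_distrib)

definition hcomp_vec :: "nat \<Rightarrow> 'k::field_char_0 S ^ 'n \<Rightarrow> 'k S ^ 'n"
  where "hcomp_vec n v = (\<chi> i. hcomp n (v $ i))"

text \<open>Recursion on the list exposes the multiple of the head, so that proofs can remove the
  regular elements one by one.\<close>

fun ideal_list :: "'k::field_char_0 S list \<Rightarrow> 'k S set"
  where "ideal_list [] = {0}"
  | "ideal_list (l # ls) = {l * p + q | p q. q \<in> ideal_list ls}"

fun ideal_times :: "'k::field_char_0 S list \<Rightarrow> ('k S ^ 'n) set \<Rightarrow> ('k S ^ 'n) set"
  where "ideal_times [] M = {0}"
  | "ideal_times (l # ls) M = {l *s v + w | v w. v \<in> M \<and> w \<in> ideal_times ls M}"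

text \<open>The regular sequence is listed in reverse: its last element is the head of the list.\<close>

fun regular_rev :: "'k::field_char_0 S list \<Rightarrow> ('k S ^ 'n) set \<Rightarrow> bool"
  where "regular_rev [] M \<longleftrightarrow> True"
  | "regular_rev (l # ls) M \<longleftrightarrow>
      regular_rev ls M \<and> (\<forall>u\<in>M. l *s u \<in> ideal_times ls M \<longrightarrow> u \<in> ideal_times ls M)"

lemma hcomp_vec_add: "hcomp_vec n (v + w) = hcomp_vec n v + hcomp_vec n w"
  by (simp add: hcomp_vec_def vec_eq_iff hcomp_add)

lemma hcomp_vec_zero [simp]: "hcomp_vec n 0 = 0"
  by (simp add: hcomp_vec_def vec_eq_iff)

lemma hcomp_vec_hcomp_vec: "hcomp_vec n (hcomp_vec k v) = (if n = k then hcomp_vec n v else 0)"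
  by (simp add: hcomp_vec_def vec_eq_iff hcomp_hcomp)

lemma hcomp_vec_homogeneous_scale:
  "homogeneous m p \<Longrightarrow> hcomp_vec n (p *s v) = (if m \<le> n then p *s hcomp_vec (n - m) v else 0)"
  by (simp add: hcomp_vec_def vec_eq_iff hcomp_homogeneous_mult)

lemma sum_hcomp_vec: "\<exists>N. (\<Sum>n<N. hcomp_vec n v) = v"
proof -
  have "\<forall>i. \<exists>N. \<forall>n\<ge>N. hcomp n (v $ i) = 0" by (simp add: hcomp_bound)
  then obtain N where N: "\<And>i n. n \<ge> N i \<Longrightarrow> hcomp n (v $ i) = 0" by metis
  have "(\<Sum>n<Max (range N). hcomp n (v $ i)) = v $ i" for i
  proof (rule sum_hcomp, intro allI impI)
    fix n assume "Max (range N) \<le> n"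
    moreover have "N i \<le> Max (range N)" by (rule Max_ge) auto
    ultimately show "hcomp n (v $ i) = 0" by (intro N) simp
  qed
  then show ?thesis
    by (intro exI[of _ "Max (range N)"]) (simp add: vec_eq_iff hcomp_vec_def)
qed

lemma ideal_list_ConsI: "q \<in> ideal_list ls \<Longrightarrow> l * p + q \<in> ideal_list (l # ls)"
  by auto

lemma ideal_times_ConsI: "v \<in> M \<Longrightarrow> w \<in> ideal_times ls M \<Longrightarrow> l *s v + w \<in> ideal_times (l # ls) M"
  by auto

lemma ideal_list_zero: "0 \<in> ideal_list ls"
proof (induction ls)
  case (Cons l ls)
  then show ?case using ideal_list_ConsI[of 0 ls l 0] by simp
qed simp

lemma ideal_list_add: "p \<in> ideal_list ls \<Longrightarrow> q \<in> ideal_list ls \<Longrightarrow> p + q \<in> ideal_list ls"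
proof (induction ls arbitrary: p q)
  case (Cons l ls)
  then obtain p1 p2 q1 q2 where "p = l * p1 + p2" "q = l * q1 + q2"
    "p2 \<in> ideal_list ls" "q2 \<in> ideal_list ls" by auto
  moreover from this have "p + q = l * (p1 + q1) + (p2 + q2)" by (simp add: algebra_simps)
  ultimately show ?case using ideal_list_ConsI[OF Cons.IH] by metis
qed simp

lemma ideal_list_mult: "p \<in> ideal_list ls \<Longrightarrow> r * p \<in> ideal_list ls"
proof (induction ls arbitrary: p)
  case (Cons l ls)
  then obtain p1 p2 where "p = l * p1 + p2" "p2 \<in> ideal_list ls" by auto
  moreover from this have "r * p = l * (r * p1) + r * p2" by (simp add: algebra_simps)
  ultimately show ?case using ideal_list_ConsI[OF Cons.IH] by metis
qed simp

lemma ideal_list_sum: "(\<And>a. a \<in> A \<Longrightarrow> f a \<in> ideal_list ls) \<Longrightarrow> sum f A \<in> ideal_list ls"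
  by (induction A rule: infinite_finite_induct) (auto simp: ideal_list_zero ideal_list_add)

lemma ideal_list_hcomp:
  "\<forall>l\<in>set ls. homogeneous 1 l \<Longrightarrow> p \<in> ideal_list ls \<Longrightarrow> hcomp n p \<in> ideal_list ls"
proof (induction ls arbitrary: p)
  case (Cons l ls)
  then obtain p1 p2 where p: "p = l * p1 + p2" "p2 \<in> ideal_list ls" by auto
  have "hcomp n (l * p1) = l * (if 1 \<le> n then hcomp (n - 1) p1 else 0)"
    using Cons.prems hcomp_homogeneous_mult[of 1 l n p1] by auto
  then have "hcomp n p = l * (if 1 \<le> n then hcomp (n - 1) p1 else 0) + hcomp n p2"
    by (simp add: p hcomp_add)
  moreover have "hcomp n p2 \<in> ideal_list ls" using Cons p by auto
  ultimately show ?case by (metis ideal_list_ConsI)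
qed simp

text \<open>The polynomials congruent to a constant form a subring, and it contains the variables.
  Coefficients modulo the ideal are thus scalars of \<open>kvec\<close>.\<close>

lemma diff_Const_in_ideal_list:
  assumes "\<And>i. X i \<in> ideal_list ls"
  shows "\<exists>c. p - Const c \<in> ideal_list ls"
proof (induction p rule: S_induct)
  case (Const c)
  then show ?case using ideal_list_zero by (intro exI[of _ c]) simp
next
  case (X i)
  then show ?case using assms by (intro exI[of _ 0]) (simp add: Const_simps)
next
  case (add p q)
  then obtain c d where "p - Const c \<in> ideal_list ls" "q - Const d \<in> ideal_list ls" by blast
  then have "(p - Const c) + (q - Const d) \<in> ideal_list ls" by (rule ideal_list_add)
  then show ?case by (intro exI[of _ "c + d"]) (simp add: Const_simps algebra_simps)
next
  case (mult p q)
  then obtain c d where "p - Const c \<in> ideal_list ls" "q - Const d \<in> ideal_list ls" by blast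
  then have "q * (p - Const c) + Const c * (q - Const d) \<in> ideal_list ls"
    by (intro ideal_list_add ideal_list_mult)
  then show ?case by (intro exI[of _ "c * d"]) (simp add: Const_simps algebra_simps)
qed

context
  fixes M :: "('k::field_char_0 S ^ 'n) set"
  assumes M: "svec.subspace M"
begin

lemma subspace_ideal_times: "svec.subspace (ideal_times ls M)"
proof (induction ls)
  case Nil
  then show ?case by (simp add: svec.subspace_def)
next
  case (Cons l ls)
  show ?case
  proof (rule svec.subspaceI)
    show "0 \<in> ideal_times (l # ls) M"
      using ideal_times_ConsI[OF svec.subspace_0[OF M] svec.subspace_0[OF Cons], of l] by simp
  next
    fix u v assume "u \<in> ideal_times (l # ls) M" "v \<in> ideal_times (l # ls) M"
    then obtain u1 u2 v1 v2 where "u = l *s u1 + u2" "v = l *s v1 + v2"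
      and *: "u1 \<in> M" "v1 \<in> M" "u2 \<in> ideal_times ls M" "v2 \<in> ideal_times ls M" by auto
    then have "u + v = l *s (u1 + v1) + (u2 + v2)" by (simp add: svec.scale_right_distrib)
    then show "u + v \<in> ideal_times (l # ls) M"
      using ideal_times_ConsI[OF svec.subspace_add[OF M *(1,2)] svec.subspace_add[OF Cons *(3,4)]] by metis
  next
    fix c u assume "u \<in> ideal_times (l # ls) M"
    then obtain u1 u2 where "u = l *s u1 + u2" and *: "u1 \<in> M" "u2 \<in> ideal_times ls M" by auto
    then have "c *s u = l *s (c *s u1) + c *s u2"
      by (simp add: svec.scale_right_distrib mult.commute)
    then show "c *s u \<in> ideal_times (l # ls) M"
      using ideal_times_ConsI[OF svec.subspace_scale[OF M *(1)] svec.subspace_scale[OF Cons *(2)]] by metis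
  qed
qed

lemma ideal_times_Cons_mono: "ideal_times ls M \<subseteq> ideal_times (l # ls) M"
  using ideal_times_ConsI[OF svec.subspace_0[OF M], of _ ls l] by (simp del: ideal_times.simps) blast

lemma ideal_list_scale: "p \<in> ideal_list ls \<Longrightarrow> v \<in> M \<Longrightarrow> p *s v \<in> ideal_times ls M"
proof (induction ls arbitrary: p)
  case (Cons l ls)
  then obtain p1 p2 where "p = l * p1 + p2" "p2 \<in> ideal_list ls" by auto
  moreover from this have "p *s v = l *s (p1 *s v) + p2 *s v" by (simp add: svec.scale_left_distrib)
  ultimately show ?case
    using ideal_times_ConsI[OF svec.subspace_scale[OF M Cons.prems(2)] Cons.IH[OF _ Cons.prems(2)]] by metis
qed simp

text \<open>Generators of degree one raise the degree, so the component of degree \<open>n\<close>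
  involves only components of degree \<open>n - 1\<close> of \<open>M\<close>: the inductive step of
  the graded Nakayama lemma. In degree 0 nothing is left, hence the guard
  \<open>0 < n\<close>.\<close>

lemma hcomp_vec_ideal_times:
  assumes "svec.subspace N" "\<forall>l\<in>set ls. homogeneous 1 l"
    and "\<And>v. v \<in> M \<Longrightarrow> 0 < n \<Longrightarrow> hcomp_vec (n - 1) v \<in> N" "w \<in> ideal_times ls M"
  shows "hcomp_vec n w \<in> N"
  using assms(2,4)
proof (induction ls arbitrary: w)
  case Nil
  then show ?case using assms(1) by (simp add: svec.subspace_0)
next
  case (Cons l ls)
  then obtain v u where w: "w = l *s v + u" "v \<in> M" "u \<in> ideal_times ls M" by auto
  have "hcomp_vec n (l *s v) \<in> N"
    using Cons.prems(1) assms(1,3) w(2)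
    by (simp add: hcomp_vec_homogeneous_scale[of 1] svec.subspace_0 svec.subspace_scale)
  moreover have "hcomp_vec n u \<in> N" using Cons w by auto
  ultimately show ?case by (simp add: w(1) hcomp_vec_add svec.subspace_add[OF assms(1)])
qed

text \<open>Write \<open>s b = l * t b + i b\<close>. Regularity of \<open>l\<close> returns the
  same relation for \<open>t\<close>, so the argument repeats. As \<open>l\<close> has degree one,
  the component of degree \<open>n\<close> of \<open>l * t b\<close> sees only degree
  \<open>n - 1\<close> of \<open>t b\<close>, and induction on the degree ends the
  repetition.\<close>

lemma coefficients_in_ideal_descend:
  assumes reg: "regular_rev (l # ls) M" and lin: "\<forall>l\<in>set (l # ls). homogeneous 1 l"
    and T: "T \<subseteq> M"
    and hyp: "\<And>s. (\<Sum>b\<in>T. s b *s b) \<in> ideal_times (l # ls) M \<Longrightarrow> \<forall>b\<in>T. s b \<in> ideal_list (l # ls)"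
    and s: "(\<Sum>b\<in>T. s b *s b) \<in> ideal_times ls M"
  shows "\<forall>b\<in>T. s b \<in> ideal_list ls"
proof -
  have "\<forall>b\<in>T. hcomp n (s b) \<in> ideal_list ls" if "(\<Sum>b\<in>T. s b *s b) \<in> ideal_times ls M" for n s
    using that
  proof (induction n arbitrary: s rule: less_induct)
    case (less n)
    have "\<forall>b\<in>T. s b \<in> ideal_list (l # ls)"
      using less.prems ideal_times_Cons_mono hyp by blast
    then have "\<forall>b\<in>T. \<exists>t i. s b = l * t + i \<and> i \<in> ideal_list ls" by simp
    then obtain t i where ti: "\<And>b. b \<in> T \<Longrightarrow> s b = l * t b + i b"
      "\<And>b. b \<in> T \<Longrightarrow> i b \<in> ideal_list ls" by metis
    have "(\<Sum>b\<in>T. s b *s b) = l *s (\<Sum>b\<in>T. t b *s b) + (\<Sum>b\<in>T. i b *s b)"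
      by (simp add: svec.scale_sum_right sum.distrib[symmetric] ti(1) svec.scale_left_distrib cong: sum.cong)
    then have "l *s (\<Sum>b\<in>T. t b *s b) = (\<Sum>b\<in>T. s b *s b) - (\<Sum>b\<in>T. i b *s b)"
      by simp
    moreover have "(\<Sum>b\<in>T. i b *s b) \<in> ideal_times ls M"
      using T ti(2) by (intro svec.subspace_sum[OF subspace_ideal_times]) (auto intro: ideal_list_scale)
    ultimately have "l *s (\<Sum>b\<in>T. t b *s b) \<in> ideal_times ls M"
      using less.prems by (simp add: svec.subspace_diff[OF subspace_ideal_times])
    moreover have "(\<Sum>b\<in>T. t b *s b) \<in> M"
      using T by (intro svec.subspace_sum[OF M]) (auto intro: svec.subspace_scale[OF M])
    ultimately have t: "(\<Sum>b\<in>T. t b *s b) \<in> ideal_times ls M"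
      using reg by simp
    show ?case
    proof
      fix b assume b: "b \<in> T"
      have "hcomp n (s b) = (if 1 \<le> n then l * hcomp (n - 1) (t b) else 0) + hcomp n (i b)"
        using lin hcomp_homogeneous_mult[of 1 l n "t b"] by (simp add: ti(1)[OF b] hcomp_add)
      moreover have "(if 1 \<le> n then l * hcomp (n - 1) (t b) else 0) \<in> ideal_list ls"
        using less.IH[OF _ t, of "n - 1"] b by (auto simp: ideal_list_zero intro: ideal_list_mult)
      moreover have "hcomp n (i b) \<in> ideal_list ls"
        using lin ti(2)[OF b] by (intro ideal_list_hcomp) auto
      ultimately show "hcomp n (s b) \<in> ideal_list ls"
        by (simp only: ideal_list_add)
    qed
  qed
  then have "(\<Sum>n<N. hcomp n (s b)) \<in> ideal_list ls" if "b \<in> T" for b N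
    using s that by (intro ideal_list_sum) blast
  then show ?thesis using sum_hcomp hcomp_bound by metis
qed

text \<open>The descent runs along the whole list and ends at the empty list, whose ideal is zero;
  there the given relation enters.\<close>

lemma coefficients_zero:
  assumes "regular_rev ls M" "\<forall>l\<in>set ls. homogeneous 1 l" "T \<subseteq> M"
    and "\<And>s. (\<Sum>b\<in>T. s b *s b) \<in> ideal_times ls M \<Longrightarrow> \<forall>b\<in>T. s b \<in> ideal_list ls"
    and "(\<Sum>b\<in>T. s b *s b) = 0"
  shows "\<forall>b\<in>T. s b = 0"
  using assms(1,2,4)
proof (induction ls)
  case Nil
  then show ?case using assms(5) by simp
next
  case (Cons l ls)
  have "\<forall>b\<in>T. s b \<in> ideal_list ls" if "(\<Sum>b\<in>T. s b *s b) \<in> ideal_times ls M" for s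
    using coefficients_in_ideal_descend[OF Cons.prems(1,2) assms(3) Cons.prems(3) that] .
  then show ?case using Cons by auto
qed

text \<open>Auslander--Buchsbaum for graded submodules: a basis is obtained by lifting homogeneously
  a \<open>k\<close>-basis of \<open>M\<close> modulo the ideal generated by the regular sequence.\<close>

theorem free_if_regular:
  assumes graded: "\<And>v n. v \<in> M \<Longrightarrow> hcomp_vec n v \<in> M"
    and reg: "regular_rev ls M" and lin: "\<forall>l\<in>set ls. homogeneous 1 l"
    and gen: "\<And>i. X i \<in> ideal_list ls"
  shows "free_submodule M"
proof -
  let ?mM = "ideal_times ls M"
  define Hom where "Hom = {v \<in> M. \<exists>n. hcomp_vec n v = v}"
  have ksub: "kvec.subspace N" if "svec.subspace N" for N :: "('k S ^ 'n) set"
    using that by (simp add: kvec.subspace_def svec.subspace_def)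
  \<comment> \<open>\<open>B0\<close> is a basis of \<open>?mM\<close> over the field. Extending it
    inside \<open>B0 \<union> Hom\<close> makes all new vectors homogeneous, and they form a basis
    of \<open>M\<close> modulo \<open>?mM\<close>.\<close>
  obtain B0 where B0: "B0 \<subseteq> ?mM" "kvec.independent B0" "?mM \<subseteq> kvec.span B0"
    using kvec.maximal_independent_subset by blast
  have B0_span: "kvec.span B0 = ?mM"
    using B0(1,3) kvec.span_minimal[OF _ ksub[OF subspace_ideal_times]] by blast
  obtain B1 where B1: "B0 \<subseteq> B1" "B1 \<subseteq> B0 \<union> Hom" "kvec.independent B1" "B0 \<union> Hom \<subseteq> kvec.span B1"
    using kvec.maximal_independent_subset_extend[of B0 "B0 \<union> Hom"] B0(2) by blast
  define B where "B = B1 - B0"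
  have B_Hom: "B \<subseteq> Hom" using B1(2) by (auto simp: B_def)
  then have B_M: "B \<subseteq> M" by (auto simp: Hom_def)
  have B1_eq: "B1 = B0 \<union> B" using B1(1) by (auto simp: B_def)
  have span_B_kspan: "kvec.span B \<subseteq> svec.span B"
    by (rule kvec.span_minimal[OF svec.span_superset ksub[OF svec.subspace_span]])
  have hcomp_span: "hcomp_vec n v \<in> svec.span B" if "v \<in> M" for n v
    using that
  proof (induction n arbitrary: v rule: less_induct)
    case (less n)
    let ?h = "hcomp_vec n v"
    have "hcomp_vec n ?h = ?h" by (simp add: hcomp_vec_hcomp_vec)
    then have "?h \<in> Hom" using graded[OF less.prems, of n] unfolding Hom_def by blast
    then have "?h \<in> kvec.span (B0 \<union> B)" using B1(4) B1_eq by auto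
    then obtain m b where h: "?h = m + b" "m \<in> ?mM" "b \<in> kvec.span B"
      unfolding kvec.span_Un B0_span by blast
    \<comment> \<open>The summand \<open>b\<close> may have parts of other degrees as well; its part
      of degree \<open>n\<close> stays in the span because \<open>B\<close> consists of homogeneous
      vectors.\<close>
    have "hcomp_vec n b \<in> kvec.span B"
      using h(3)
    proof (induction rule: kvec.span_induct_alt)
      case base
      then show ?case by (simp add: kvec.span_zero)
    next
      case (step c x y)
      from step(1) B_Hom obtain k where "hcomp_vec k x = x" unfolding Hom_def by blast
      then have "hcomp_vec n x = x \<or> hcomp_vec n x = 0"
        using hcomp_vec_hcomp_vec[of n k x] by (metis (full_types))
      then have "hcomp_vec n x \<in> kvec.span B"
        using step(1) by (auto simp: kvec.span_zero kvec.span_base)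
      then show ?case
        using step(2)
        by (simp add: hcomp_vec_add hcomp_vec_homogeneous_scale[OF homogeneous_Const]
            kvec.span_add kvec.span_scale)
    qed
    then have "hcomp_vec n b \<in> svec.span B" using span_B_kspan by blast
    moreover have "hcomp_vec n m \<in> svec.span B"
      by (rule hcomp_vec_ideal_times[OF svec.subspace_span lin _ h(2)]) (use less.IH in simp)
    moreover have "?h = hcomp_vec n m + hcomp_vec n b"
      using \<open>hcomp_vec n ?h = ?h\<close> h(1) by (metis hcomp_vec_add)
    ultimately show ?case by (simp add: svec.span_add)
  qed
  have "svec.span B = M"
  proof
    show "svec.span B \<subseteq> M" by (rule svec.span_minimal[OF B_M M])
    show "M \<subseteq> svec.span B"
    proof
      fix v assume "v \<in> M"
      then have "(\<Sum>n<N. hcomp_vec n v) \<in> svec.span B" for N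
        by (intro svec.span_sum hcomp_span)
      then show "v \<in> svec.span B" using sum_hcomp_vec by metis
    qed
  qed
  moreover have "\<not> svec.dependent B"
    unfolding svec.dependent_explicit
  proof (intro notI, elim exE conjE bexE)
    fix T s v assume T: "finite T" "T \<subseteq> B" "(\<Sum>b\<in>T. s b *s b) = 0" and v: "v \<in> T" "s v \<noteq> 0"
    have "\<forall>b\<in>T. s b \<in> ideal_list ls" if s: "(\<Sum>b\<in>T. s b *s b) \<in> ?mM" for s
    proof -
      have "\<exists>c. s b - Const c \<in> ideal_list ls" for b
        using gen by (rule diff_Const_in_ideal_list)
      then obtain c where c: "\<And>b. s b - Const (c b) \<in> ideal_list ls" by metis
      \<comment> \<open>Modulo \<open>?mM\<close> each coefficient may be replaced by its constant,
        which leaves linear algebra over the field.\<close>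
      have "(\<Sum>b\<in>T. (s b - Const (c b)) *s b) \<in> ?mM"
        using T(2) B_M c
        by (intro svec.subspace_sum[OF subspace_ideal_times]) (auto intro: ideal_list_scale)
      from svec.subspace_diff[OF subspace_ideal_times s this]
      have sum_c: "(\<Sum>b\<in>T. Const (c b) *s b) \<in> kvec.span B0"
        by (simp add: B0_span svec.scale_left_diff_distrib sum_subtractf)
      have "c b = 0" if b: "b \<in> T" for b
      proof (rule ccontr)
        assume c0: "c b \<noteq> 0"
        let ?V = "kvec.span (B1 - {b})"
        have "B0 \<subseteq> B1 - {b}" using b T(2) B1(1) by (auto simp: B_def)
        then have "(\<Sum>b\<in>T. Const (c b) *s b) \<in> ?V" using sum_c kvec.span_mono by blast
        moreover have "(\<Sum>b\<in>T - {b}. Const (c b) *s b) \<in> ?V"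
          using T(2) by (intro kvec.span_sum kvec.span_scale kvec.span_base) (auto simp: B_def)
        ultimately have "Const (c b) *s b \<in> ?V"
          using kvec.span_diff by (fastforce simp: sum.remove[OF T(1) b])
        then have "Const (inverse (c b)) *s (Const (c b) *s b) \<in> ?V" by (rule kvec.span_scale)
        then have "b \<in> ?V" using c0 by (simp add: Const_simps(4)[symmetric] Const_simps(2))
        moreover have "b \<in> B1" using b T(2) by (auto simp: B_def)
        ultimately show False using B1(3) unfolding kvec.dependent_def by blast
      qed
      then show ?thesis using c by (metis Const_simps(1) diff_zero)
    qed
    then have "\<forall>b\<in>T. s b = 0"
      using T B_M by (intro coefficients_zero[OF reg lin]) auto
    then show False using v by blast
  qed
  ultimately show ?thesis unfolding free_submodule_def by blast
qed

text \<open>Coordinates in a basis turn the equation into one in \<open>S\<close> for each basis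
  vector, where \<open>colon\<close> applies.\<close>

lemma free_submodule_colon:
  assumes free: "free_submodule M" and uvw: "u \<in> M" "v \<in> M" "w \<in> M" "z *s u = x *s v + y *s w"
    and colon: "\<And>p q r. z * p = x * q + y * r \<Longrightarrow> \<exists>q' r'. p = x * q' + y * r'"
  shows "\<exists>v'\<in>M. \<exists>w'\<in>M. u = x *s v' + y *s w'"
proof -
  obtain B where B: "svec.independent B" "svec.span B = M"
    using free unfolding free_submodule_def by blast
  let ?r = "svec.representation B"
  have "?r (z *s u) = ?r (x *s v + y *s w)" by (simp add: uvw(4))
  then have "z * ?r u b = x * ?r v b + y * ?r w b" for b
    using uvw(1-3) B(1) unfolding B(2)[symmetric]
    by (simp add: svec.representation_add svec.representation_scale svec.span_scale fun_eq_iff)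
  then have "\<forall>b. \<exists>q' r'. ?r u b = x * q' + y * r'" using colon by blast
  then obtain q r where qr: "\<And>b. ?r u b = x * q b + y * r b" by metis
  \<comment> \<open>Summing over the support of \<open>u\<close> keeps the sums finite; elsewhere
    the chosen \<open>q b\<close> and \<open>r b\<close> need not vanish.\<close>
  let ?T = "{b. ?r u b \<noteq> 0}"
  have T: "?T \<subseteq> B" using svec.representation_ne_zero by blast
  have "u = (\<Sum>b\<in>?T. ?r u b *s b)"
    using svec.sum_nonzero_representation_eq[OF B(1)] uvw(1) B(2) by simp
  also have "\<dots> = x *s (\<Sum>b\<in>?T. q b *s b) + y *s (\<Sum>b\<in>?T. r b *s b)"
    by (simp add: qr svec.scale_sum_right svec.scale_left_distrib sum.distrib)
  finally have "u = x *s (\<Sum>b\<in>?T. q b *s b) + y *s (\<Sum>b\<in>?T. r b *s b)" .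
  moreover have "(\<Sum>b\<in>?T. s b *s b) \<in> M" for s
    using T B(2) by (intro svec.subspace_sum[OF M] svec.subspace_scale[OF M]) (auto intro: svec.span_base)
  ultimately show ?thesis by blast
qed

end


section \<open>Substitutions and colon conditions\<close>

text \<open>\<open>q\<close> is a nonzerodivisor modulo \<open>l\<close>.\<close>

definition prime_to :: "'a::comm_semiring_1 \<Rightarrow> 'a \<Rightarrow> bool"
  where "prime_to l q \<longleftrightarrow> (\<forall>p. l dvd q * p \<longrightarrow> l dvd p)"

text \<open>\<open>z\<close> is a nonzerodivisor on \<open>M\<close> modulo \<open>(x, y) M\<close>.
  The elementwise form involves only addition and scaling, so it passes through linear
  bijections.\<close>

definition colon_closed :: "'k::field_char_0 S \<Rightarrow> 'k S \<Rightarrow> 'k S \<Rightarrow> ('k S ^ 'n) set \<Rightarrow> bool"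
  where "colon_closed z x y M \<longleftrightarrow> (\<forall>u\<in>M. \<forall>v\<in>M. \<forall>w\<in>M. z *s u = x *s v + y *s w \<longrightarrow>
    (\<exists>v'\<in>M. \<exists>w'\<in>M. u = x *s v' + y *s w'))"

definition subst_vec :: "(4 \<Rightarrow> 'k S) \<Rightarrow> 'k::field_char_0 S ^ 'n \<Rightarrow> 'k S ^ 'n"
  where "subst_vec s v = (\<chi> i. subst s (v $ i))"

lemma X_inj [simp]: "X i = (X j :: 'k::field_char_0 S) \<longleftrightarrow> i = j"
proof
  assume "X i = (X j :: 'k S)"
  then have "Poly_Mapping.lookup (X i :: 'k S) (Poly_Mapping.single i 1) = Poly_Mapping.lookup (X j) (Poly_Mapping.single i 1)"
    by simp
  then have "Poly_Mapping.single i (1::nat) = Poly_Mapping.single j 1"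
    by (auto simp: X_def lookup_single when_def split: if_splits)
  then show "i = j" by (metis lookup_single_eq lookup_single_not_eq one_neq_zero)
qed simp

lemma X_neq_0 [simp]: "X i \<noteq> (0 :: 'k::field_char_0 S)"
proof
  assume "X i = (0 :: 'k S)"
  then have "Poly_Mapping.lookup (X i :: 'k S) (Poly_Mapping.single i 1) = 0" by simp
  then show False by (simp add: X_def)
qed

text \<open>The kernel of \<open>subst s\<close> is generated by \<open>l\<close> and its values lie
  in a domain, so \<open>l\<close> generates a prime ideal, which does not contain
  \<open>q\<close>.\<close>

lemma prime_toI:
  fixes l q :: "'k::field_char_0 S"
  assumes "\<And>i. l dvd X i - s i" "subst s l = 0" "subst s q \<noteq> 0"
  shows "prime_to l q"
  unfolding prime_to_def
proof (intro allI impI)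
  fix p assume "l dvd q * p"
  then obtain k where "q * p = l * k" by (auto simp: dvd_def)
  from arg_cong[OF this, of "subst s"] have "subst s (q * p) = 0"
    using assms(2) by (simp add: subst_mult)
  then have "subst s p = 0" using assms(3) by (simp add: subst_mult)
  then show "l dvd p" using dvd_diff_subst[of l s p] assms(1) by simp
qed

lemma dvd_X_diff_upd: "X j - q dvd X i - (X(j := q)) i"
  by simp

lemma prime_to_X_diff:
  assumes "i \<noteq> k" "subst (X(i := X k)) q \<noteq> 0"
  shows "prime_to (X i - X k) q"
  by (rule prime_toI[OF dvd_X_diff_upd _ assms(2)]) (use assms(1) in \<open>simp add: subst_simps\<close>)

lemma prime_to_power:
  fixes l q :: "'a::idom"
  assumes "prime_to l q" "l \<noteq> 0"
  shows "prime_to (l ^ n) q"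
proof (induction n)
  case 0
  then show ?case by (simp add: prime_to_def)
next
  case (Suc n)
  show ?case unfolding prime_to_def
  proof (intro allI impI)
    fix p assume d: "l ^ Suc n dvd q * p"
    then have "l dvd q * p" by (metis dvd_mult_left power_Suc)
    then obtain r where r: "p = l * r" using assms(1) by (auto simp: prime_to_def dvd_def)
    have "l * l ^ n dvd l * (q * r)" using d by (simp add: r mult.left_commute)
    then have "l ^ n dvd q * r" using assms(2) by simp
    then have "l ^ n dvd r" using Suc unfolding prime_to_def by blast
    then show "l ^ Suc n dvd p" unfolding r power_Suc by (rule mult_dvd_mono[OF dvd_refl])
  qed
qed

text \<open>Every two-term relation is a multiple of the Koszul relation; \<open>n\<close> is the
  common cofactor.\<close>

lemma prime_to_vec:
  fixes x y :: "'k::field_char_0 S" and v w :: "'k S ^ 'n"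
  assumes "prime_to y x" "y \<noteq> 0" "x *s v = y *s w"
  obtains n where "v = y *s n" "w = x *s n"
proof -
  have "x * v $ i = y * w $ i" for i using assms(3) by (simp add: vec_eq_iff)
  then have "\<forall>i. \<exists>r. v $ i = y * r"
    using assms(1) unfolding prime_to_def dvd_def by metis
  then obtain r where r: "\<And>i. v $ i = y * r i" by metis
  have "y * w $ i = y * (x * r i)" for i
    using \<open>x * v $ i = y * w $ i\<close>[symmetric] by (simp only: r mult.left_commute)
  then have "w $ i = x * r i" for i using assms(2) mult_cancel_left by blast
  then show thesis
    by (intro that[of "\<chi> i. r i"]) (simp_all add: vec_eq_iff r)
qed

lemma subst_vec_add: "subst_vec s (v + w) = subst_vec s v + subst_vec s w"
  by (simp add: subst_vec_def vec_eq_iff subst_add)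

lemma subst_vec_scale: "subst_vec s (p *s v) = subst s p *s subst_vec s v"
  by (simp add: subst_vec_def vec_eq_iff subst_mult)

lemma subst_vec_decompose:
  assumes "\<And>i. l dvd X i - s i"
  obtains v' where "v = subst_vec s v + l *s v'"
proof -
  have "\<forall>i. \<exists>r. v $ i - subst s (v $ i) = l * r"
    using dvd_diff_subst[of l s] assms by (auto simp: dvd_def)
  then obtain r where r: "\<And>i. v $ i - subst s (v $ i) = l * r i" by metis
  have "v = subst_vec s v + l *s (\<chi> i. r i)"
    by (simp add: vec_eq_iff subst_vec_def r[symmetric])
  then show thesis by (rule that)
qed

lemma colon_closed_commute: "colon_closed z x y M \<longleftrightarrow> colon_closed z y x M"
  unfolding colon_closed_def by (metis add.commute)

context
  fixes M :: "('k::field_char_0 S ^ 'n) set"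
  assumes M: "svec.subspace M"
    and sat: "\<And>p v. p \<noteq> 0 \<Longrightarrow> p *s v \<in> M \<Longrightarrow> v \<in> M"
begin

lemma subst_vec_decompose_saturated:
  assumes "\<And>i. l dvd X i - s i" "l \<noteq> 0" "\<And>v. v \<in> M \<Longrightarrow> subst_vec s v \<in> M" "v \<in> M"
  obtains v' where "v' \<in> M" "v = subst_vec s v + l *s v'"
proof -
  obtain v' where v': "v = subst_vec s v + l *s v'"
    by (rule subst_vec_decompose[of l s]) (use assms in auto)
  have "v - subst_vec s v \<in> M" using assms(3,4) by (simp add: svec.subspace_diff[OF M])
  then have "l *s v' \<in> M" using v' by (metis add_diff_cancel_left')
  then show thesis using that sat assms(2) v' by blast
qed

text \<open>Modulo \<open>x\<close> the relation has only two terms, so the image of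
  \<open>u\<close> is a multiple of \<open>subst s y\<close>, with cofactor in \<open>M\<close> by
  saturation. It remains to replace \<open>subst s y\<close> by \<open>y\<close>, from which it
  differs by a multiple of \<open>x\<close>.\<close>

lemma colon_closed_if_subst_kills_generator:
  assumes s: "\<And>i. x dvd X i - s i" "x \<noteq> 0" "\<And>v. v \<in> M \<Longrightarrow> subst_vec s v \<in> M"
    and "subst s x = 0" and prime: "subst s y \<noteq> 0" "prime_to (subst s y) (subst s z)"
  shows "colon_closed z x y M"
  unfolding colon_closed_def
proof (intro ballI impI)
  fix u v w assume uvw: "u \<in> M" "v \<in> M" "w \<in> M" "z *s u = x *s v + y *s w"
  from arg_cong[OF uvw(4), of "subst_vec s"] assms(4)
  have "subst s z *s subst_vec s u = subst s y *s subst_vec s w"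
    by (simp add: subst_vec_add subst_vec_scale)
  then obtain n where n: "subst_vec s u = subst s y *s n"
    using prime_to_vec[OF prime(2,1)] by blast
  have nM: "n \<in> M" using sat[OF prime(1)] s(3)[OF uvw(1)] n by metis
  obtain u' where u': "u' \<in> M" "u = subst_vec s u + x *s u'"
    by (rule subst_vec_decompose_saturated[OF s uvw(1)])
  obtain h where h: "y - subst s y = x * h"
    using dvd_diff_subst[of x s y] s(1) by (auto simp: dvd_def)
  have "u = subst s y *s n + x *s u'" using u'(2) unfolding n .
  also have "subst s y = y - x * h" using h by (simp add: algebra_simps)
  finally have "u = x *s (u' - h *s n) + y *s n"
    by (simp add: vec_eq_iff algebra_simps)
  moreover have "u' - h *s n \<in> M" by (intro svec.subspace_diff[OF M] svec.subspace_scale[OF M] u' nM)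
  ultimately show "\<exists>v'\<in>M. \<exists>w'\<in>M. u = x *s v' + y *s w'" using nM by blast
qed

text \<open>Setting \<open>z\<close> to zero leaves a relation between \<open>x\<close> and
  \<open>y\<close>, so \<open>v\<close> and \<open>w\<close> are, up to multiples of
  \<open>z\<close>, the two halves of a Koszul relation. The halves cancel in
  \<open>x *s v + y *s w\<close>, and \<open>z\<close> can be divided out.\<close>

lemma colon_closed_if_subst_kills_multiplier:
  assumes s: "\<And>i. z dvd X i - s i" "z \<noteq> 0" "\<And>v. v \<in> M \<Longrightarrow> subst_vec s v \<in> M"
    and "subst s z = 0" "subst s x = x" "subst s y = y" and prime: "x \<noteq> 0" "y \<noteq> 0" "prime_to y x"
  shows "colon_closed z x y M"
  unfolding colon_closed_def
proof (intro ballI impI)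
  fix u v w assume uvw: "u \<in> M" "v \<in> M" "w \<in> M" "z *s u = x *s v + y *s w"
  from arg_cong[OF uvw(4), of "subst_vec s"] assms(4-6)
  have "0 = x *s subst_vec s v + y *s subst_vec s w"
    by (simp add: subst_vec_add subst_vec_scale)
  then have "x *s subst_vec s v = y *s (- subst_vec s w)"
    by (simp add: svec.scale_minus_right eq_neg_iff_add_eq_0)
  then obtain n where n: "subst_vec s v = y *s n" "- subst_vec s w = x *s n"
    using prime_to_vec[OF prime(3,2)] by blast
  obtain v' where v': "v' \<in> M" "v = subst_vec s v + z *s v'"
    by (rule subst_vec_decompose_saturated[OF s uvw(2)])
  obtain w' where w': "w' \<in> M" "w = subst_vec s w + z *s w'"
    by (rule subst_vec_decompose_saturated[OF s uvw(3)])
  have "subst_vec s w = - (x *s n)" using n(2) by (metis minus_minus)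
  then have vw: "v = y *s n + z *s v'" "w = - (x *s n) + z *s w'"
    using v'(2) w'(2) n(1) by simp_all
  have "z *s u = z *s (x *s v' + y *s w')"
    unfolding uvw(4) vw by (simp add: vec_eq_iff algebra_simps)
  then have "u = x *s v' + y *s w'" using s(2) by (simp add: vec_eq_iff)
  then show "\<exists>v'\<in>M. \<exists>w'\<in>M. u = x *s v' + y *s w'" using v' w' by blast
qed

end

lemma prime_to_X_diff_X_diff:
  assumes "i \<noteq> j" "i \<noteq> k" "j \<noteq> k"
  shows "prime_to (X i - X k) (X j - X k)"
  by (rule prime_to_X_diff) (use assms in \<open>simp_all add: subst_simps\<close>)

text \<open>Applied to constant vectors, this gives the colon condition of the ring itself.\<close>

lemma colon_closed_UNIV:
  assumes "distinct [i, j, k, l]"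
  shows "colon_closed (X l - X i) (X j - X i) (X k - X i) UNIV"
proof (rule colon_closed_if_subst_kills_generator[where s = "X(j := X i)"])
  have ne: "i \<noteq> j" "k \<noteq> j" "l \<noteq> j" "k \<noteq> i" "l \<noteq> i" "k \<noteq> l" using assms by auto
  then show "prime_to (subst (X(j := X i)) (X k - X i)) (subst (X(j := X i)) (X l - X i))"
    by (simp add: subst_simps prime_to_X_diff_X_diff)
qed (use assms in \<open>auto simp: subst_simps svec.subspace_def\<close>)

text \<open>The ring endomorphism \<open>translate\<close> restricts polynomials to \<open>X 0 = 0\<close> and fixes the
  polynomials in the differences of the variables.\<close>

definition translate :: "4 \<Rightarrow> 'k::field_char_0 S"
  where "translate i = X i - X 0"

lemma subst_translate_X_diff: "subst translate (X i - X j) = X i - X j"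
  by (simp add: translate_def subst_simps)

lemma dvd_X_diff_translate: "X 0 dvd X i - translate i"
  by (simp add: translate_def)

lemma prime_to_X: "j \<noteq> k \<Longrightarrow> prime_to (X i) (X j - X k)"
  by (rule prime_toI[where s = "X(i := 0)"]) (auto simp: subst_simps)

lemma prime_to_X_diff_X: "i \<noteq> k \<Longrightarrow> prime_to (X i - X k) (X j)"
  by (rule prime_to_X_diff) simp_all


section \<open>Syzygies on the triangles of \<open>K\<^sub>4\<close>\<close>

lemma all_4_iff: "(\<forall>k::4. P k) \<longleftrightarrow> P 0 \<and> P 1 \<and> P 2 \<and> P 3"
  by (metis UNIV_A3 UNIV_I empty_iff insert_iff)

lemma sum_UNIV_4: "(\<Sum>k\<in>UNIV. f k) = f 0 + f 1 + f 2 + f (3::4)"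
  unfolding UNIV_A3 by (simp add: add.assoc)

lemma UNIV_4_minus:
  "UNIV - {0::4} = {1,2,3}" "UNIV - {1::4} = {0,2,3}" "UNIV - {2::4} = {0,1,3}" "UNIV - {3::4} = {0,1,2}"
  unfolding UNIV_A3 by auto

lemma edges_triangle:
  "edges {1,2,3} = {(1,2),(1,3),(2,3)}" "edges {0,2,3} = {(0,2),(0,3),(2,3)}"
  "edges {0,1,3} = {(0,1),(0,3),(1,3)}" "edges {0,1,2} = {(0,1),(0,2),(1,2)}"
  by (auto simp: edges_def less_bit0_def bit0.Rep_numeral bit0.Rep_0 bit0.Rep_1)

lemma finite_edges [simp]: "finite (edges \<sigma>)"
  by (rule finite_subset[of _ UNIV]) auto

lemma edges_mono: "\<sigma> \<subseteq> \<tau> \<Longrightarrow> edges \<sigma> \<subseteq> edges \<tau>"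
  by (auto simp: edges_def)

lemma edge_family_0_0 [simp]: "edge_family u01 u02 u03 u12 u13 u23 (0,0) = 0"
  by (simp add: edge_family_def)

lemma edge_family_not_edge: "p \<notin> edges UNIV \<Longrightarrow> edge_family u01 u02 u03 u12 u13 u23 p = 0"
  by (auto simp: edges_all edge_family_def)

lemma subspace_syzygies: "svec.subspace (syzygies \<alpha> \<sigma>)"
  by (rule svec.subspaceI)
    (auto simp: syzygies_def distrib_right sum.distrib mult.assoc sum_distrib_left[symmetric])

lemma syzygies_saturated: "p \<noteq> 0 \<Longrightarrow> p *s v \<in> syzygies \<alpha> \<sigma> \<Longrightarrow> v \<in> syzygies \<alpha> \<sigma>"
  by (auto simp: syzygies_def mult.assoc sum_distrib_left[symmetric])

lemma syzygies_mono:
  assumes "\<sigma> \<subseteq> \<tau>"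
  shows "syzygies \<alpha> \<sigma> \<subseteq> syzygies \<alpha> \<tau>"
proof
  fix g assume g: "g \<in> syzygies \<alpha> \<sigma>"
  have "(\<Sum>p\<in>edges \<tau>. g $ p * \<alpha> p) = (\<Sum>p\<in>edges \<sigma>. g $ p * \<alpha> p)"
    using g edges_mono[OF assms] by (intro sum.mono_neutral_right) (auto simp: syzygies_def)
  then show "g \<in> syzygies \<alpha> \<tau>"
    using g edges_mono[OF assms] by (auto simp: syzygies_def)
qed

lemma subst_vec_syzygies:
  assumes "\<And>p. p \<in> edges \<sigma> \<Longrightarrow> subst s (\<alpha> p) = \<alpha> p" "g \<in> syzygies \<alpha> \<sigma>"
  shows "subst_vec s g \<in> syzygies \<alpha> \<sigma>"
proof -
  have "(\<Sum>p\<in>edges \<sigma>. subst s (g $ p) * \<alpha> p) = subst s (\<Sum>p\<in>edges \<sigma>. g $ p * \<alpha> p)"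
    using assms(1) by (simp add: subst_simps)
  then show ?thesis using assms(2) by (simp add: syzygies_def subst_vec_def)
qed

section \<open>Koszul syzygies\<close>

definition koszul :: "('n \<Rightarrow> 'k::field_char_0 S) \<Rightarrow> 'n \<Rightarrow> 'n \<Rightarrow> 'k S ^ 'n"
  where "koszul \<alpha> p q = (\<chi> r. \<alpha> p * of_bool (r = q) - \<alpha> q * of_bool (r = p))"

lemma koszul_syzygy:
  assumes "p \<in> edges \<sigma>" "q \<in> edges \<sigma>"
  shows "koszul \<alpha> p q \<in> syzygies \<alpha> \<sigma>"
proof -
  have "(\<Sum>r\<in>edges \<sigma>. koszul \<alpha> p q $ r * \<alpha> r)
      = (\<Sum>r\<in>edges \<sigma>. (if r = q then \<alpha> p * \<alpha> q else 0) - (if r = p then \<alpha> q * \<alpha> p else 0))"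
    by (rule sum.cong) (auto simp: koszul_def)
  also have "\<dots> = 0" using assms by (simp add: sum_subtractf)
  finally show ?thesis using assms by (auto simp: syzygies_def koszul_def)
qed

text \<open>The Koszul differential squares to zero on three generators. If \<open>p\<close> and
  \<open>q\<close> are opposite edges and \<open>r\<close> meets both, the right-hand side consists
  of triangle syzygies.\<close>

lemma koszul_exchange: "\<alpha> r *s koszul \<alpha> p q = \<alpha> p *s koszul \<alpha> r q - \<alpha> q *s koszul \<alpha> r p"
  by (simp add: vec_eq_iff koszul_def algebra_simps)

text \<open>The contributions along \<open>p\<close> add up to the relation that \<open>s\<close>
  satisfies and vanish. One generator thus turns any syzygy into a combination of Koszul
  syzygies.\<close>

lemma scale_syzygy_koszul:
  assumes "s \<in> syzygies \<alpha> \<sigma>" "p \<in> edges \<sigma>"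
  shows "\<alpha> p *s s = (\<Sum>q\<in>edges \<sigma>. s $ q *s koszul \<alpha> p q)"
proof -
  have "(\<Sum>q\<in>edges \<sigma>. s $ q *s koszul \<alpha> p q) $ r = \<alpha> p * s $ r" for r
  proof -
    have "(\<Sum>q\<in>edges \<sigma>. s $ q *s koszul \<alpha> p q) $ r
        = (\<Sum>q\<in>edges \<sigma>. (if r = q then \<alpha> p * s $ r else 0) - of_bool (r = p) * (s $ q * \<alpha> q))"
      unfolding sum_component by (rule sum.cong) (auto simp: koszul_def algebra_simps)
    also have "\<dots> = (if r \<in> edges \<sigma> then \<alpha> p * s $ r else 0)"
      using assms(1) by (simp add: sum_subtractf sum_distrib_left[symmetric] syzygies_def)
    also have "\<dots> = \<alpha> p * s $ r" using assms(1) unfolding syzygies_def by (cases "r \<in> edges \<sigma>") (simp, metis (mono_tags, lifting) mem_Collect_eq mult_zero_right)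
    finally show ?thesis .
  qed
  then show ?thesis by (simp add: vec_eq_iff)
qed

text \<open>\<open>orient k\<close> is the boundary of the triangle that omits \<open>k\<close>, with the sign that it has in the
  boundary of the tetrahedron: every edge cancels in the sum over \<open>k\<close>.\<close>

definition orient :: "4 \<Rightarrow> 4 \<times> 4 \<Rightarrow> 'k::field_char_0 S"
  where "orient k =
    (if k = 0 then edge_family 0 0 0 1 (-1) 1
     else if k = 1 then edge_family 0 (-1) 1 0 0 (-1)
     else if k = 2 then edge_family 1 0 (-1) 0 1 0
     else edge_family (-1) 1 0 (-1) 0 0)"

lemma orient_simps [simp]:
  "orient 0 = edge_family 0 0 0 1 (-1) 1" "orient 1 = edge_family 0 (-1) 1 0 0 (-1)"
  "orient 2 = edge_family 1 0 (-1) 0 1 0" "orient 3 = edge_family (-1) 1 0 (-1) 0 0"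
  by (simp_all add: orient_def)

lemma orient_support: "p \<notin> edges (UNIV - {k}) \<Longrightarrow> orient k p = 0"
proof -
  have "\<forall>k. p \<notin> edges (UNIV - {k}) \<longrightarrow> orient k p = 0"
    unfolding all_4_iff UNIV_4_minus edges_triangle by (simp add: edge_family_def)
  then show "p \<notin> edges (UNIV - {k}) \<Longrightarrow> orient k p = 0" by blast
qed

text \<open>If \<open>h\<close> holds the quotients of the differences theta_i - theta_j, then going
  around a triangle gives zero; the signs make this a syzygy.\<close>

definition restrict_triangle :: "4 \<Rightarrow> 'k::field_char_0 S ^ (4 \<times> 4) \<Rightarrow> 'k S ^ (4 \<times> 4)"
  where "restrict_triangle k h = (\<chi> p. orient k p * h $ p)"

lemma restrict_triangle_linear:
  "restrict_triangle k (g + h) = restrict_triangle k g + restrict_triangle k h"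
  "restrict_triangle k (p *s h) = p *s restrict_triangle k h"
  by (simp_all add: restrict_triangle_def vec_eq_iff algebra_simps)

lemma sum_restrict_triangle: "(\<Sum>k\<in>UNIV. restrict_triangle k h) = 0"
proof -
  have "(\<Sum>k\<in>UNIV. orient k p) = (0 :: 'a S)" for p
    by (cases "p \<in> edges UNIV") (auto simp: sum_UNIV_4 edges_all edge_family_not_edge)
  then show ?thesis
    by (simp add: vec_eq_iff restrict_triangle_def sum_distrib_right[symmetric])
qed

text \<open>The two families in the theorem differ by signs of the linear forms; a choice of sign at
  each edge covers both.\<close>

locale braid_powers =
  fixes \<alpha> :: "4 \<times> 4 \<Rightarrow> 'k::field_char_0 S" and m :: "4 \<times> 4 \<Rightarrow> nat"
  assumes alpha: "(i, j) \<in> edges UNIV \<Longrightarrow>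
    \<alpha> (i, j) = (X i - X j) ^ m (i, j) \<or> \<alpha> (i, j) = (X j - X i) ^ m (i, j)"
begin

abbreviation "tri k \<equiv> syzygies \<alpha> (UNIV - {k})"

definition tri_sum :: "('k S ^ (4 \<times> 4)) set"
  where "tri_sum = {\<Sum>k\<in>UNIV. n k | n. \<forall>k. n k \<in> tri k}"

text \<open>The coordinate \<open>(0,0)\<close> is free; it accounts for the constant derivation \<open>\<Sum>\<^sub>i \<partial>\<^sub>i\<close>.\<close>

definition cocycles :: "('k S ^ (4 \<times> 4)) set"
  where "cocycles =
    {h. (\<forall>p. p \<notin> edges UNIV \<longrightarrow> p \<noteq> (0,0) \<longrightarrow> h $ p = 0) \<and> (\<forall>k. restrict_triangle k h \<in> tri k)}"

lemma restrict_triangle_in_tri_iff: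
  "(\<forall>k. restrict_triangle k h \<in> tri k) \<longleftrightarrow>
    h $ (1,2) * \<alpha> (1,2) + h $ (2,3) * \<alpha> (2,3) = h $ (1,3) * \<alpha> (1,3) \<and>
    h $ (0,2) * \<alpha> (0,2) + h $ (2,3) * \<alpha> (2,3) = h $ (0,3) * \<alpha> (0,3) \<and>
    h $ (0,1) * \<alpha> (0,1) + h $ (1,3) * \<alpha> (1,3) = h $ (0,3) * \<alpha> (0,3) \<and>
    h $ (0,1) * \<alpha> (0,1) + h $ (1,2) * \<alpha> (1,2) = h $ (0,2) * \<alpha> (0,2)"
proof -
  have in_tri: "restrict_triangle k h \<in> tri k \<longleftrightarrow>
      (\<Sum>p\<in>edges (UNIV - {k}). orient k p * (h $ p * \<alpha> p)) = 0" for k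
    by (simp add: syzygies_def restrict_triangle_def orient_support mult.assoc)
  have "a + (c - b) = 0 \<longleftrightarrow> a + c = b" for a b c :: "'k S"
    by (auto simp: algebra_simps)
  then show ?thesis
    unfolding all_4_iff in_tri unfolding UNIV_4_minus edges_triangle
    by (auto simp: eq_diff_eq diff_eq_eq)
qed

text \<open>Exactness at the direct sum of the triangle modules: the two triangles on an edge have
  opposite coefficients there, since the other two vanish on it, and so they define one edge
  value.\<close>

lemma glue:
  assumes n: "\<And>k. n k \<in> tri k" and sum: "(\<Sum>k\<in>UNIV. n k) = 0"
  shows "\<exists>h\<in>cocycles. h $ (0,0) = 0 \<and> (\<forall>k. restrict_triangle k h = n k)"
proof -
  \<comment> \<open>Each edge takes its value from the one of its two triangles where
    \<open>orient\<close> is 1.\<close>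
  define h where "h = (\<chi> p. edge_family (n 2 $ (0,1)) (n 3 $ (0,2)) (n 1 $ (0,3))
    (n 0 $ (1,2)) (n 2 $ (1,3)) (n 0 $ (2,3)) p)"
  have s: "n 0 $ p + n 1 $ p + n 2 $ p + n 3 $ p = 0" for p
    using arg_cong[OF sum, of "\<lambda>v. v $ p"] by (simp add: sum_UNIV_4)
  have z: "p \<notin> edges (UNIV - {k}) \<Longrightarrow> n k $ p = 0" for k p
    using n[of k] unfolding syzygies_def by blast
  note z0 = z[of _ 0, unfolded UNIV_4_minus edges_triangle]
    and z1 = z[of _ 1, unfolded UNIV_4_minus edges_triangle]
    and z2 = z[of _ 2, unfolded UNIV_4_minus edges_triangle]
    and z3 = z[of _ 3, unfolded UNIV_4_minus edges_triangle]
  have opposite: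
    "n 3 $ (0,1) = - n 2 $ (0,1)" "n 1 $ (0,2) = - n 3 $ (0,2)" "n 2 $ (0,3) = - n 1 $ (0,3)"
    "n 3 $ (1,2) = - n 0 $ (1,2)" "n 0 $ (1,3) = - n 2 $ (1,3)" "n 1 $ (2,3) = - n 0 $ (2,3)"
    using s[of "(0,1)"] s[of "(0,2)"] s[of "(0,3)"] s[of "(1,2)"] s[of "(1,3)"] s[of "(2,3)"]
    by (simp_all add: z0 z1 z2 z3 eq_neg_iff_add_eq_0 add.commute)
  have "\<forall>k. orient k p * h $ p = n k $ p" if "p \<in> edges UNIV" for p
    using that unfolding edges_all all_4_iff
    by (elim insertE emptyE; simp add: h_def z0 z1 z2 z3 opposite)
  moreover have "\<forall>k. orient k p * h $ p = n k $ p" if p: "p \<notin> edges UNIV" for p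
  proof -
    have "p \<notin> edges (UNIV - {k})" for k
      using p edges_mono[of "UNIV - {k}" UNIV] by blast
    then show ?thesis by (simp add: orient_support z)
  qed
  ultimately have "orient k p * h $ p = n k $ p" for k p by blast
  then have h: "restrict_triangle k h = n k" for k
    by (simp add: restrict_triangle_def vec_eq_iff)
  have "h \<in> cocycles"
    using n by (simp add: cocycles_def h) (simp add: h_def edge_family_not_edge)
  moreover have "h $ (0,0) = 0" by (simp add: h_def)
  ultimately show ?thesis using h by blast
qed

lemma cocycle_eqI:
  assumes "g \<in> cocycles" "h \<in> cocycles" "g $ (0,0) = h $ (0,0)"
    and "\<And>k. restrict_triangle k g = restrict_triangle k h"
  shows "g = h"
proof -
  have eq: "orient k p * g $ p = orient k p * h $ p" for k p
    using arg_cong[OF assms(4), of "\<lambda>v. v $ p"] by (simp add: restrict_triangle_def)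
  \<comment> \<open>The triangles that omit 0, 1 and 2 already cover all six edges.\<close>
  have "g $ p = h $ p" if "p \<in> edges UNIV" for p
    using that eq[of 0 p] eq[of 1 p] eq[of 2 p] unfolding edges_all by auto
  moreover have "g $ p = h $ p" if "p \<notin> edges UNIV" for p
    using that assms(1-3) unfolding cocycles_def by (cases "p = (0,0)") (simp, metis (mono_tags, lifting) mem_Collect_eq)
  ultimately show ?thesis by (auto simp: vec_eq_iff)
qed

lemma subspace_cocycles: "svec.subspace cocycles"
proof (rule svec.subspaceI)
  show "0 \<in> cocycles" by (simp add: cocycles_def restrict_triangle_in_tri_iff)
next
  fix g h assume "g \<in> cocycles" "h \<in> cocycles"
  then show "g + h \<in> cocycles"
    by (simp add: cocycles_def restrict_triangle_linear svec.subspace_add[OF subspace_syzygies])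
next
  fix p h assume "h \<in> cocycles"
  then show "p *s h \<in> cocycles"
    by (simp add: cocycles_def restrict_triangle_linear svec.subspace_scale[OF subspace_syzygies])
qed

lemma subspace_tri_sum: "svec.subspace tri_sum"
proof (rule svec.subspaceI)
  show "0 \<in> tri_sum"
    unfolding tri_sum_def using svec.subspace_0[OF subspace_syzygies]
    by (auto intro!: exI[of _ "\<lambda>_. 0"])
next
  fix u v assume "u \<in> tri_sum" "v \<in> tri_sum"
  then obtain p q where "u = (\<Sum>k\<in>UNIV. p k)" "v = (\<Sum>k\<in>UNIV. q k)" and pq: "\<And>k. p k \<in> tri k" "\<And>k. q k \<in> tri k"
    unfolding tri_sum_def by blast
  then have "u + v = (\<Sum>k\<in>UNIV. p k + q k)" by (simp add: sum.distrib)
  then show "u + v \<in> tri_sum"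
    unfolding tri_sum_def using svec.subspace_add[OF subspace_syzygies pq] by blast
next
  fix c u assume "u \<in> tri_sum"
  then obtain p where "u = (\<Sum>k\<in>UNIV. p k)" and p: "\<And>k. p k \<in> tri k"
    unfolding tri_sum_def by blast
  then have "c *s u = (\<Sum>k\<in>UNIV. c *s p k)" by (simp add: svec.scale_sum_right)
  then show "c *s u \<in> tri_sum"
    unfolding tri_sum_def using svec.subspace_scale[OF subspace_syzygies p] by blast
qed

lemma tri_subset_tri_sum: "tri k \<subseteq> tri_sum"
proof
  fix g assume "g \<in> tri k"
  then have "\<forall>j. (if j = k then g else 0) \<in> tri j"
    using svec.subspace_0[OF subspace_syzygies] by auto
  moreover have "g = (\<Sum>j\<in>UNIV. if j = k then g else 0)" by simp
  ultimately show "g \<in> tri_sum" unfolding tri_sum_def by blast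
qed

lemma tri_sum_subset: "tri_sum \<subseteq> syzygies \<alpha> UNIV"
proof
  fix g assume "g \<in> tri_sum"
  then obtain n where g: "g = (\<Sum>k\<in>UNIV. n k)" and n: "\<And>k. n k \<in> tri k"
    unfolding tri_sum_def by blast
  show "g \<in> syzygies \<alpha> UNIV"
    unfolding g using n syzygies_mono[of _ UNIV \<alpha>]
    by (intro svec.subspace_sum[OF subspace_syzygies]) blast
qed

lemma generated_iff: "syzygies_generated_by_triangles \<alpha> \<longleftrightarrow> syzygies \<alpha> UNIV \<subseteq> tri_sum"
proof -
  have "tri 3 + tri 2 + tri 1 + tri 0 = tri_sum"
  proof (intro equalityI subsetI)
    fix g assume "g \<in> tri 3 + tri 2 + tri 1 + tri 0"
    then obtain a b c d where "g = a + b + c + d" "a \<in> tri 3" "b \<in> tri 2" "c \<in> tri 1" "d \<in> tri 0"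
      by (auto elim!: set_plus_elim)
    then show "g \<in> tri_sum"
      using tri_subset_tri_sum by (auto intro!: svec.subspace_add[OF subspace_tri_sum])
  next
    fix g assume "g \<in> tri_sum"
    then obtain n where g: "g = (\<Sum>k\<in>UNIV. n k)" and n: "\<And>k. n k \<in> tri k"
      unfolding tri_sum_def by blast
    have "g = n 3 + n 2 + n 1 + n 0" by (simp add: g sum_UNIV_4)
    then show "g \<in> tri 3 + tri 2 + tri 1 + tri 0"
      using n by (auto intro!: set_plus_intro)
  qed
  then show ?thesis
    using tri_sum_subset
    unfolding syzygies_generated_by_triangles_def UNIV_4_minus UNIV_A3[symmetric] by auto
qed

section \<open>Generation and the colon condition on cocycles\<close>

abbreviation "x \<equiv> X 1 - X 0 :: 'k S"
abbreviation "y \<equiv> X 2 - X 0 :: 'k S"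
abbreviation "z \<equiv> X 3 - X 0 :: 'k S"

text \<open>The generators are powers of differences, so only differences inside the vertex set
  matter; the variable of an omitted vertex may be moved freely.\<close>

lemma subst_alpha:
  assumes "p \<in> edges \<sigma>" "\<And>i j. i \<in> \<sigma> \<Longrightarrow> j \<in> \<sigma> \<Longrightarrow> s i - s j = X i - X j"
  shows "subst s (\<alpha> p) = \<alpha> p"
proof -
  obtain i j where p: "p = (i, j)" "i \<in> \<sigma>" "j \<in> \<sigma>" "(i, j) \<in> edges UNIV"
    using assms(1) by (auto simp: edges_def)
  show ?thesis
    using alpha[OF p(4)] assms(2)[OF p(2,3)] assms(2)[OF p(3,2)] by (auto simp: p(1) subst_simps)
qed

text \<open>The variable of the omitted vertex can be equated with any other. The choice decides
  which form becomes zero: \<open>x\<close> for the vertices 0 and 1, \<open>y\<close> for 2, and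
  the multiplier \<open>z\<close> for 3.\<close>

lemma colon_closed_tri: "colon_closed z x y (tri k)"
proof -
  have inv: "subst_vec (X(i := X j)) g \<in> tri i" if "g \<in> tri i" for i j g
    using that by (intro subst_vec_syzygies subst_alpha) auto
  note closed = subspace_syzygies syzygies_saturated dvd_X_diff_upd
  have "colon_closed z x y (tri 0)"
  proof (rule colon_closed_if_subst_kills_generator[where s = "X(0 := X 1)", OF closed(1,2)])
    show "x dvd X i - (X(0 := X 1)) i" for i
      using dvd_X_diff_upd[of 0 "X 1" i] by (metis dvd_minus_iff minus_diff_eq minus_dvd_iff)
  qed (simp_all add: inv subst_simps prime_to_X_diff_X_diff)
  moreover have "colon_closed z x y (tri 1)"
    by (rule colon_closed_if_subst_kills_generator[where s = "X(1 := X 0)", OF closed])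
      (simp_all add: inv subst_simps prime_to_X_diff_X_diff)
  moreover have "colon_closed z y x (tri 2)"
    by (rule colon_closed_if_subst_kills_generator[where s = "X(2 := X 0)", OF closed])
      (simp_all add: inv subst_simps prime_to_X_diff_X_diff)
  then have "colon_closed z x y (tri 2)" by (simp only: colon_closed_commute)
  moreover have "colon_closed z x y (tri 3)"
    by (rule colon_closed_if_subst_kills_multiplier[where s = "X(3 := X 0)", OF closed])
      (simp_all add: inv subst_simps prime_to_X_diff_X_diff)
  ultimately have "\<forall>k. colon_closed z x y (tri k)" unfolding all_4_iff by blast
  then show ?thesis by blast
qed

lemma colon_closed_cocycles_if_generated:
  assumes gen: "syzygies \<alpha> UNIV \<subseteq> tri_sum"
  shows "colon_closed z x y cocycles"
  unfolding colon_closed_def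
proof (intro ballI impI)
  fix u v w assume uvw: "u \<in> cocycles" "v \<in> cocycles" "w \<in> cocycles" "z *s u = x *s v + y *s w"
  let ?T = restrict_triangle
  have tri: "?T k h \<in> tri k" if "h \<in> cocycles" for k h using that by (simp add: cocycles_def)
  have "z *s ?T k u = x *s ?T k v + y *s ?T k w" for k
    using arg_cong[OF uvw(4), of "?T k"] by (simp only: restrict_triangle_linear)
  then have "\<forall>k. \<exists>p q. p \<in> tri k \<and> q \<in> tri k \<and> ?T k u = x *s p + y *s q"
    using colon_closed_tri tri[OF uvw(1)] tri[OF uvw(2)] tri[OF uvw(3)]
    unfolding colon_closed_def by metis
  then obtain p q where pq: "\<And>k. p k \<in> tri k" "\<And>k. q k \<in> tri k"
    "\<And>k. ?T k u = x *s p k + y *s q k" by metis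
  \<comment> \<open>The solutions on the four triangles need not glue. Their sums over
    \<open>k\<close> measure the failure, and the relation between these sums makes it a Koszul
    multiple of a single syzygy \<open>n\<close>.\<close>
  have "x *s (\<Sum>k\<in>UNIV. p k) + y *s (\<Sum>k\<in>UNIV. q k) = (\<Sum>k\<in>UNIV. ?T k u)"
    by (simp only: pq(3) svec.scale_sum_right sum.distrib)
  then have "x *s (\<Sum>k\<in>UNIV. p k) + y *s (\<Sum>k\<in>UNIV. q k) = 0"
    by (simp only: sum_restrict_triangle)
  then have "x *s (\<Sum>k\<in>UNIV. p k) = y *s (- (\<Sum>k\<in>UNIV. q k))"
    by (simp only: svec.scale_minus_right eq_neg_iff_add_eq_0)
  from prime_to_vec[OF _ _ this] obtain n where
    n: "(\<Sum>k\<in>UNIV. p k) = y *s n" "- (\<Sum>k\<in>UNIV. q k) = x *s n"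
    by (auto simp: prime_to_X_diff_X_diff)
  have "(\<Sum>k\<in>UNIV. p k) \<in> syzygies \<alpha> UNIV"
    using tri_sum_subset pq(1) unfolding tri_sum_def by blast
  then have "n \<in> syzygies \<alpha> UNIV" unfolding n(1) by (rule syzygies_saturated[rotated]) simp
  then obtain s where s: "n = (\<Sum>k\<in>UNIV. s k)" "\<And>k. s k \<in> tri k"
    using gen unfolding tri_sum_def by blast
  \<comment> \<open>Splitting \<open>n\<close> into triangle syzygies corrects \<open>p\<close> by
    \<open>- y *s s\<close> and \<open>q\<close> by \<open>x *s s\<close>: both sums become zero,
    while the combination with \<open>x\<close> and \<open>y\<close> is unchanged.\<close>
  have "(\<Sum>k\<in>UNIV. p k - y *s s k) = 0"
    by (simp add: sum_subtractf svec.scale_sum_right[symmetric] n(1) s(1))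
  moreover have "p k - y *s s k \<in> tri k" for k
    by (intro svec.subspace_diff[OF subspace_syzygies] svec.subspace_scale[OF subspace_syzygies] pq(1) s(2))
  ultimately obtain v1 where v1: "v1 \<in> cocycles" "\<And>k. ?T k v1 = p k - y *s s k"
    using glue[of "\<lambda>k. p k - y *s s k"] by blast
  have "(\<Sum>k\<in>UNIV. q k + x *s s k) = (\<Sum>k\<in>UNIV. q k) + x *s n"
    by (simp only: sum.distrib svec.scale_sum_right s(1))
  then have "(\<Sum>k\<in>UNIV. q k + x *s s k) = 0" by (simp only: n(2)[symmetric] add.right_inverse)
  moreover have "q k + x *s s k \<in> tri k" for k
    by (intro svec.subspace_add[OF subspace_syzygies] svec.subspace_scale[OF subspace_syzygies] pq(2) s(2))
  ultimately obtain w1 where w1: "w1 \<in> cocycles" "\<And>k. ?T k w1 = q k + x *s s k"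
    using glue[of "\<lambda>k. q k + x *s s k"] by blast
  \<comment> \<open>Restriction to triangles does not see the coordinate \<open>(0,0)\<close>. It is
    solved separately in the ring, and the vectors \<open>?e r\<close> adjust it without changing
    any restriction.\<close>
  let ?e = "\<lambda>r. axis (0,0) r :: 'k S ^ (4 \<times> 4)"
  have orient_0: "orient k (0,0) = (0 :: 'k S)" for k
    by (rule orient_support) (simp add: edges_def)
  have Te: "?T k (?e r) = 0" for k r
    by (simp add: restrict_triangle_def vec_eq_iff axis_def orient_0)
  have e: "?e r \<in> cocycles" for r
    by (auto simp: cocycles_def Te svec.subspace_0[OF subspace_syzygies]) (auto simp: axis_def)
  define u0 where "u0 = u $ (0,0) - (x * v1 $ (0,0) + y * w1 $ (0,0))"
  have zu: "z * u $ (0,0) = x * v $ (0,0) + y * w $ (0,0)"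
    using arg_cong[OF uvw(4), of "\<lambda>v. v $ (0,0)"] by simp
  have "z * u0 = x * (v $ (0,0) - z * v1 $ (0,0)) + y * (w $ (0,0) - z * w1 $ (0,0))"
    unfolding u0_def right_diff_distrib zu by (simp add: algebra_simps)
  then have "z *s (\<chi> i::4. u0) = x *s (\<chi> i. v $ (0,0) - z * v1 $ (0,0)) + y *s (\<chi> i. w $ (0,0) - z * w1 $ (0,0))"
    by (simp add: vec_eq_iff)
  moreover have "colon_closed z x y (UNIV :: ('k S ^ 4) set)"
    by (rule colon_closed_UNIV) simp
  ultimately obtain r t :: "'k S ^ 4" where "(\<chi> i::4. u0) = x *s r + y *s t"
    unfolding colon_closed_def by blast
  from arg_cong[OF this, of "\<lambda>v. v $ 0"] have u0: "u0 = x * r $ 0 + y * t $ 0" by simp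
  let ?v = "v1 + ?e (r $ 0)" and ?w = "w1 + ?e (t $ 0)"
  have vw: "?v \<in> cocycles" "?w \<in> cocycles"
    using v1(1) w1(1) e by (auto intro: svec.subspace_add[OF subspace_cocycles])
  have "u = x *s ?v + y *s ?w"
  proof (rule cocycle_eqI)
    show "x *s ?v + y *s ?w \<in> cocycles"
      by (intro svec.subspace_add[OF subspace_cocycles] svec.subspace_scale[OF subspace_cocycles] vw)
    have "u $ (0,0) = u0 + (x * v1 $ (0,0) + y * w1 $ (0,0))" by (simp add: u0_def)
    also have "\<dots> = (x *s ?v + y *s ?w) $ (0,0)"
      unfolding u0 by (simp only: vector_add_component vector_smult_component axis_nth distrib_left ac_simps)
    finally show "u $ (0,0) = (x *s ?v + y *s ?w) $ (0,0)" .
    show "?T k u = ?T k (x *s ?v + y *s ?w)" for k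
      unfolding pq(3) restrict_triangle_linear v1(2) w1(2) Te
      by (simp add: vec_eq_iff algebra_simps)
  qed (rule uvw(1))
  then show "\<exists>v'\<in>cocycles. \<exists>w'\<in>cocycles. u = x *s v' + y *s w'" using vw by blast
qed

text \<open>Comparing lifts of \<open>x *s s\<close>, \<open>y *s s\<close> and
  \<open>z *s s\<close> in pairs gives three cocycles tied by the Koszul relation of
  \<open>x\<close>, \<open>y\<close>, \<open>z\<close>. The colon condition then splits
  \<open>A\<close>, and this allows the lift of \<open>x *s s\<close> to be changed into one
  divisible by \<open>x\<close>.\<close>

lemma tri_sum_saturated:
  assumes cc: "colon_closed z x y cocycles"
    and s: "x *s s \<in> tri_sum" "y *s s \<in> tri_sum" "z *s s \<in> tri_sum"
  shows "s \<in> tri_sum"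
proof -
  let ?T = restrict_triangle
  obtain p q r where p: "x *s s = (\<Sum>k\<in>UNIV. p k)" "\<And>k. p k \<in> tri k"
    and q: "y *s s = (\<Sum>k\<in>UNIV. q k)" "\<And>k. q k \<in> tri k"
    and r: "z *s s = (\<Sum>k\<in>UNIV. r k)" "\<And>k. r k \<in> tri k"
    using s unfolding tri_sum_def by blast
  note closed = svec.subspace_diff[OF subspace_syzygies] svec.subspace_add[OF subspace_syzygies]
    svec.subspace_scale[OF subspace_syzygies]
  have glue_diff: "\<exists>h\<in>cocycles. h $ (0,0) = 0 \<and> (\<forall>k. ?T k h = b *s f k - a *s g k)"
    if f: "a *s s = (\<Sum>k\<in>UNIV. f k)" "\<And>k. f k \<in> tri k" and g: "b *s s = (\<Sum>k\<in>UNIV. g k)" "\<And>k. g k \<in> tri k"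
    for a b f g
  proof -
    have "(\<Sum>k\<in>UNIV. b *s f k - a *s g k) = b *s (a *s s) - a *s (b *s s)"
      by (simp only: sum_subtractf svec.scale_sum_right f(1) g(1))
    also have "\<dots> = 0" by (simp add: mult.commute)
    finally show ?thesis
      by (intro glue closed f(2) g(2))
  qed
  obtain A where A: "A \<in> cocycles" "A $ (0,0) = 0" "\<And>k. ?T k A = y *s p k - x *s q k" using glue_diff[OF p q] by blast
  obtain B where B: "B \<in> cocycles" "B $ (0,0) = 0" "\<And>k. ?T k B = z *s p k - x *s r k" using glue_diff[OF p r] by blast
  obtain C where C: "C \<in> cocycles" "C $ (0,0) = 0" "\<And>k. ?T k C = z *s q k - y *s r k" using glue_diff[OF q r] by blast
  \<comment> \<open>The identity holds on every triangle, and at \<open>(0,0)\<close> because the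
    cocycles were glued with value 0 there.\<close>
  have "z *s A = x *s (- C) + y *s B"
  proof (rule cocycle_eqI)
    show "x *s (- C) + y *s B \<in> cocycles"
      using B(1) C(1)
      by (intro svec.subspace_add[OF subspace_cocycles] svec.subspace_scale[OF subspace_cocycles]
          svec.subspace_neg[OF subspace_cocycles])
    show "z *s A \<in> cocycles" using A(1) by (rule svec.subspace_scale[OF subspace_cocycles])
    show "(z *s A) $ (0,0) = (x *s (- C) + y *s B) $ (0,0)" using A(2) B(2) C(2) by simp
    have neg: "?T k (- C) = - ?T k C" for k by (simp add: restrict_triangle_def vec_eq_iff)
    show "?T k (z *s A) = ?T k (x *s (- C) + y *s B)" for k
      unfolding restrict_triangle_linear neg A(3) B(3) C(3) by (simp add: vec_eq_iff algebra_simps)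
  qed
  then obtain F G where FG: "F \<in> cocycles" "G \<in> cocycles" "A = x *s F + y *s G"
    using cc A(1) B(1) svec.subspace_neg[OF subspace_cocycles C(1)] unfolding colon_closed_def by blast
  have "\<exists>n. n \<in> tri k \<and> p k - ?T k G = x *s n" for k
  proof -
    have "y *s p k - x *s q k = x *s ?T k F + y *s ?T k G"
      using A(3)[of k] by (simp add: FG(3) restrict_triangle_linear)
    then have "x *s (q k + ?T k F) = y *s (p k - ?T k G)"
      by (simp add: svec.scale_right_distrib svec.scale_right_diff_distrib algebra_simps)
    from prime_to_vec[OF _ _ this[symmetric]] obtain n where n: "p k - ?T k G = x *s n"
      by (auto simp: prime_to_X_diff_X_diff)
    have "p k - ?T k G \<in> tri k" using p(2) FG(2) by (auto simp: cocycles_def intro: closed)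
    then have "n \<in> tri k" unfolding n by (rule syzygies_saturated[rotated]) simp
    then show ?thesis using n by blast
  qed
  then obtain n where n: "\<And>k. n k \<in> tri k" "\<And>k. p k - ?T k G = x *s n k" by metis
  \<comment> \<open>Changing \<open>p\<close> by the restrictions of \<open>G\<close> is harmless,
    since these sum to zero.\<close>
  have "x *s s = (\<Sum>k\<in>UNIV. p k - ?T k G)"
    by (simp only: sum_subtractf sum_restrict_triangle p(1) diff_zero)
  also have "\<dots> = x *s (\<Sum>k\<in>UNIV. n k)" by (simp only: n(2) svec.scale_sum_right)
  finally have "s = (\<Sum>k\<in>UNIV. n k)" by (simp add: vec_eq_iff)
  then show ?thesis using n(1) unfolding tri_sum_def by blast
qed

section \<open>Powers of x, y and z that carry syzygies into the triangle sum\<close>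

lemma add_power_scale_tri_sum:
  assumes "f ^ a *s v \<in> tri_sum" "g ^ b *s v \<in> tri_sum"
  shows "(f + g) ^ (a + b) *s v \<in> tri_sum"
proof -
  have scale: "h * c *s v \<in> tri_sum" if "c *s v \<in> tri_sum" for h c
    using svec.subspace_scale[OF subspace_tri_sum that, of h] by simp
  \<comment> \<open>In each binomial term the exponent of \<open>f\<close> is at least
    \<open>a\<close> or that of \<open>g\<close> is at least \<open>b\<close>.\<close>
  have "(of_nat (a + b choose k) * f ^ k * g ^ (a + b - k)) *s v \<in> tri_sum" for k
  proof (cases "a \<le> k")
    case True
    then have "of_nat (a + b choose k) * f ^ k * g ^ (a + b - k)
        = (of_nat (a + b choose k) * f ^ (k - a) * g ^ (a + b - k)) * f ^ a"
      by (simp add: ac_simps flip: power_add)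
    then show ?thesis using scale[OF assms(1)] by metis
  next
    case False
    then have "a + b - k = (a - k) + b" by simp
    then have "of_nat (a + b choose k) * f ^ k * g ^ (a + b - k)
        = (of_nat (a + b choose k) * f ^ k * g ^ (a - k)) * g ^ b"
      by (simp add: power_add ac_simps)
    then show ?thesis using scale[OF assms(2)] by metis
  qed
  then show ?thesis
    unfolding binomial_ring svec.scale_sum_left by (intro svec.subspace_sum[OF subspace_tri_sum])
qed

lemma power_scale_tri_sum:
  assumes "(i, j) \<in> edges UNIV" "\<alpha> (i, j) *s v \<in> tri_sum"
  shows "(X i - X j) ^ m (i, j) *s v \<in> tri_sum" "(X j - X i) ^ m (i, j) *s v \<in> tri_sum"
proof -
  have "(X j - X i) ^ m (i, j) = (- 1) ^ m (i, j) * (X i - X j) ^ m (i, j)"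
    by (simp flip: power_mult_distrib)
  moreover have "(X i - X j) ^ m (i, j) = (- 1) ^ m (i, j) * (X j - X i) ^ m (i, j)"
    by (simp flip: power_mult_distrib)
  ultimately obtain a b where "(X i - X j) ^ m (i, j) = a * \<alpha> (i, j)" "(X j - X i) ^ m (i, j) = b * \<alpha> (i, j)"
    using alpha[OF assms(1)] by (metis mult_1)
  then show "(X i - X j) ^ m (i, j) *s v \<in> tri_sum" "(X j - X i) ^ m (i, j) *s v \<in> tri_sum"
    using svec.subspace_scale[OF subspace_tri_sum assms(2)] by simp_all
qed

lemma koszul_in_tri_sum: "{p, q} \<subseteq> edges (UNIV - {k}) \<Longrightarrow> koszul \<alpha> p q \<in> tri_sum"
  by (rule subsetD[OF tri_subset_tri_sum koszul_syzygy[of p "UNIV - {k}"]]) auto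

text \<open>Meant for opposite edges \<open>p\<close> and \<open>q\<close>: the two auxiliary edges
  share a triangle with each of them, so their generators multiply the Koszul syzygy into
  \<open>tri_sum\<close>. The signs of \<open>f\<close> and \<open>g\<close> are left open so that
  \<open>f + g\<close> can telescope to the form of a third edge.\<close>

lemma power_koszul_in_tri_sum:
  assumes "(i, j) \<in> edges UNIV" "(i', j') \<in> edges UNIV"
    and "{(i, j), p} \<subseteq> edges (UNIV - {k1})" "{(i, j), q} \<subseteq> edges (UNIV - {k2})"
    and "{(i', j'), p} \<subseteq> edges (UNIV - {k3})" "{(i', j'), q} \<subseteq> edges (UNIV - {k4})"
    and f: "f = X i - X j \<or> f = X j - X i" and g: "g = X i' - X j' \<or> g = X j' - X i'"
  shows "(f + g) ^ (m (i, j) + m (i', j')) *s koszul \<alpha> p q \<in> tri_sum"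
proof -
  have "koszul \<alpha> (i, j) p \<in> tri_sum" "koszul \<alpha> (i, j) q \<in> tri_sum"
    "koszul \<alpha> (i', j') p \<in> tri_sum" "koszul \<alpha> (i', j') q \<in> tri_sum"
    by (fact koszul_in_tri_sum[OF assms(3)] koszul_in_tri_sum[OF assms(4)]
      koszul_in_tri_sum[OF assms(5)] koszul_in_tri_sum[OF assms(6)])+
  then have "\<alpha> (i, j) *s koszul \<alpha> p q \<in> tri_sum" "\<alpha> (i', j') *s koszul \<alpha> p q \<in> tri_sum"
    unfolding koszul_exchange[of \<alpha> _ p q]
    by (simp_all add: svec.subspace_diff[OF subspace_tri_sum] svec.subspace_scale[OF subspace_tri_sum])
  then show ?thesis
    using f g power_scale_tri_sum assms(1,2) by (intro add_power_scale_tri_sum) blast+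
qed

text \<open>One power turns \<open>s\<close> into a combination of Koszul syzygies and the other
  moves each of these into \<open>tri_sum\<close>; hence the exponents add.\<close>

lemma power_scale_syzygy:
  assumes e: "(i, j) \<in> edges UNIV" and s: "s \<in> syzygies \<alpha> UNIV"
    and K: "\<And>q. q \<in> edges UNIV \<Longrightarrow> (X j - X i) ^ n *s koszul \<alpha> (i, j) q \<in> tri_sum"
  shows "(X j - X i) ^ (m (i, j) + n) *s s \<in> tri_sum"
proof -
  let ?f = "X j - X i"
  have "\<alpha> (i, j) *s (?f ^ n *s s) = ?f ^ n *s (\<alpha> (i, j) *s s)"
    by (simp add: mult.commute)
  also have "\<dots> = (\<Sum>q\<in>edges UNIV. s $ q *s (?f ^ n *s koszul \<alpha> (i, j) q))"
    unfolding scale_syzygy_koszul[OF s e] svec.scale_sum_right by (simp add: mult.commute)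
  also have "\<dots> \<in> tri_sum"
    by (intro svec.subspace_sum[OF subspace_tri_sum] svec.subspace_scale[OF subspace_tri_sum] K)
  finally have "?f ^ m (i, j) *s (?f ^ n *s s) \<in> tri_sum" by (rule power_scale_tri_sum(2)[OF e])
  then show ?thesis by (simp add: power_add)
qed

lemma powers_scale_syzygy:
  assumes s: "s \<in> syzygies \<alpha> UNIV"
  shows "\<exists>n. x ^ n *s s \<in> tri_sum" "\<exists>n. y ^ n *s s \<in> tri_sum" "\<exists>n. z ^ n *s s \<in> tri_sum"
proof -
  have edges: "edges (UNIV - {0}) = {(1,2),(1,3),(2,3)}" "edges (UNIV - {1}) = {(0,2),(0,3),(2,3)}"
    "edges (UNIV - {2}) = {(0,1),(0,3),(1,3)}" "edges (UNIV - {3}) = {(0,1),(0,2),(1,2)}"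
    by (simp_all only: UNIV_4_minus edges_triangle)
  have adjacent: "f ^ n *s koszul \<alpha> p q \<in> tri_sum"
    if "{p, q} \<subseteq> edges (UNIV - {k})" for k f n p q
    by (intro svec.subspace_scale[OF subspace_tri_sum] koszul_in_tri_sum[OF that])
  have "x ^ (m (0,1) + (m (0,2) + m (1,2))) *s s \<in> tri_sum"
  proof (rule power_scale_syzygy[OF _ s])
    \<comment> \<open>Only the opposite edge \<open>(2,3)\<close> shares no triangle with
      \<open>(0,1)\<close>. The edges \<open>(0,2)\<close> and \<open>(1,2)\<close> meet both, and
      their forms add up to \<open>x\<close>.\<close>
    have "((X 2 - X 0) + (X 1 - X 2)) ^ (m (0,2) + m (1,2)) *s koszul \<alpha> (0,1) (2,3) \<in> tri_sum"
      by (rule power_koszul_in_tri_sum[of _ _ _ _ _ 3 _ 1 3 0]) (simp_all add: edges edges_all)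
    then show "x ^ (m (0,2) + m (1,2)) *s koszul \<alpha> (0,1) q \<in> tri_sum" if "q \<in> edges UNIV" for q
      using that adjacent[of "(0,1)" q 2] adjacent[of "(0,1)" q 3] by (auto simp: edges edges_all)
  qed (simp add: edges_all)
  then show "\<exists>n. x ^ n *s s \<in> tri_sum" by blast
  have "y ^ (m (0,2) + (m (0,1) + m (1,2))) *s s \<in> tri_sum"
  proof (rule power_scale_syzygy[OF _ s])
    have "((X 1 - X 0) + (X 2 - X 1)) ^ (m (0,1) + m (1,2)) *s koszul \<alpha> (0,2) (1,3) \<in> tri_sum"
      by (rule power_koszul_in_tri_sum[of _ _ _ _ _ 3 _ 2 3 0]) (simp_all add: edges edges_all)
    then show "y ^ (m (0,1) + m (1,2)) *s koszul \<alpha> (0,2) q \<in> tri_sum" if "q \<in> edges UNIV" for q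
      using that adjacent[of "(0,2)" q 1] adjacent[of "(0,2)" q 3] by (auto simp: edges edges_all)
  qed (simp add: edges_all)
  then show "\<exists>n. y ^ n *s s \<in> tri_sum" by blast
  have "z ^ (m (0,3) + (m (0,1) + m (1,3))) *s s \<in> tri_sum"
  proof (rule power_scale_syzygy[OF _ s])
    have "((X 1 - X 0) + (X 3 - X 1)) ^ (m (0,1) + m (1,3)) *s koszul \<alpha> (0,3) (1,2) \<in> tri_sum"
      by (rule power_koszul_in_tri_sum[of _ _ _ _ _ 2 _ 3 2 0]) (simp_all add: edges edges_all)
    then show "z ^ (m (0,1) + m (1,3)) *s koszul \<alpha> (0,3) q \<in> tri_sum" if "q \<in> edges UNIV" for q
      using that adjacent[of "(0,3)" q 1] adjacent[of "(0,3)" q 2] by (auto simp: edges edges_all)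
  qed (simp add: edges_all)
  then show "\<exists>n. z ^ n *s s \<in> tri_sum" by blast
qed

text \<open>By pigeonhole a monomial of degree at least \<open>?N\<close> contains one of the three
  powers. Saturation then lowers the degree by one at a time, with \<open>k\<close> bounding the
  distance to \<open>?N\<close>, until the monomial is 1.\<close>

lemma generated_if_colon_closed_cocycles:
  assumes cc: "colon_closed z x y cocycles"
  shows "syzygies \<alpha> UNIV \<subseteq> tri_sum"
proof
  fix s assume "s \<in> syzygies \<alpha> UNIV"
  from powers_scale_syzygy[OF this] obtain nx ny nz where
    n: "x ^ nx *s s \<in> tri_sum" "y ^ ny *s s \<in> tri_sum" "z ^ nz *s s \<in> tri_sum" by blast
  let ?N = "nx + ny + nz"
  have scale: "(g * h) *s s \<in> tri_sum" if "h *s s \<in> tri_sum" for g h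
    using svec.subspace_scale[OF subspace_tri_sum that, of g] by simp
  have "(x ^ i * y ^ j * z ^ l) *s s \<in> tri_sum" if "?N \<le> i + j + l + k" for i j l k
    using that
  proof (induction k arbitrary: i j l)
    case 0
    then consider "nx \<le> i" | "ny \<le> j" | "nz \<le> l" by linarith
    then show ?case
    proof cases
      case 1
      then have "x ^ i * y ^ j * z ^ l = (x ^ (i - nx) * y ^ j * z ^ l) * x ^ nx"
        by (simp add: ac_simps flip: power_add)
      then show ?thesis using scale[OF n(1)] by metis
    next
      case 2
      then have "x ^ i * y ^ j * z ^ l = (x ^ i * y ^ (j - ny) * z ^ l) * y ^ ny"
        by (simp add: ac_simps flip: power_add)
      then show ?thesis using scale[OF n(2)] by metis
    next
      case 3
      then have "x ^ i * y ^ j * z ^ l = (x ^ i * y ^ j * z ^ (l - nz)) * z ^ nz"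
        by (simp add: ac_simps flip: power_add)
      then show ?thesis using scale[OF n(3)] by metis
    qed
  next
    case (Suc k)
    have "x * (x ^ i * y ^ j * z ^ l) = x ^ Suc i * y ^ j * z ^ l"
      "y * (x ^ i * y ^ j * z ^ l) = x ^ i * y ^ Suc j * z ^ l"
      "z * (x ^ i * y ^ j * z ^ l) = x ^ i * y ^ j * z ^ Suc l"
      by (simp_all only: power_Suc mult_ac)
    moreover have "(x ^ Suc i * y ^ j * z ^ l) *s s \<in> tri_sum"
      by (rule Suc.IH) (use Suc.prems in simp)
    moreover have "(x ^ i * y ^ Suc j * z ^ l) *s s \<in> tri_sum"
      by (rule Suc.IH) (use Suc.prems in simp)
    moreover have "(x ^ i * y ^ j * z ^ Suc l) *s s \<in> tri_sum"
      by (rule Suc.IH) (use Suc.prems in simp)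
    ultimately have "x *s ((x ^ i * y ^ j * z ^ l) *s s) \<in> tri_sum"
      "y *s ((x ^ i * y ^ j * z ^ l) *s s) \<in> tri_sum" "z *s ((x ^ i * y ^ j * z ^ l) *s s) \<in> tri_sum"
      by (simp_all only: vector_smult_assoc)
    then show ?case by (rule tri_sum_saturated[OF cc])
  qed
  from this[of 0 0 0 ?N] show "s \<in> tri_sum" by simp
qed

theorem generated_iff_colon_closed_cocycles:
  "syzygies_generated_by_triangles \<alpha> \<longleftrightarrow> colon_closed z x y cocycles"
  unfolding generated_iff
  using colon_closed_cocycles_if_generated generated_if_colon_closed_cocycles by blast

end


section \<open>Derivations and cocycles\<close>

lemma colon_closed_bij:
  fixes f :: "'k::field_char_0 S ^ 'n \<Rightarrow> 'k S ^ 'p"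
  assumes M: "svec.subspace M" and bij: "bij_betw f M N"
    and add: "\<And>u v. f (u + v) = f u + f v" and scale: "\<And>p u. f (p *s u) = p *s f u"
  shows "colon_closed z x y M \<longleftrightarrow> colon_closed z x y N"
proof -
  have image: "N = f ` M" and inj: "inj_on f M" using bij by (auto simp: bij_betw_def)
  have mem: "p *s u + q *s v \<in> M" if "u \<in> M" "v \<in> M" for p q u v
    using that by (intro svec.subspace_add[OF M] svec.subspace_scale[OF M])
  have eq: "f u = x *s f v + y *s f w \<longleftrightarrow> u = x *s v + y *s w" if "u \<in> M" "v \<in> M" "w \<in> M" for u v w
    using inj_on_eq_iff[OF inj that(1) mem[OF that(2,3)]] by (simp add: add scale)
  have eq': "z *s f u = x *s f v + y *s f w \<longleftrightarrow> z *s u = x *s v + y *s w" if "u \<in> M" "v \<in> M" "w \<in> M" for u v w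
    using inj_on_eq_iff[OF inj svec.subspace_scale[OF M that(1)] mem[OF that(2,3)], of z x y] by (simp add: add scale)
  show ?thesis
    unfolding colon_closed_def image by (simp add: eq eq')
qed

context braid_powers
begin

abbreviation derivations :: "('k S ^ 4) set"
  where "derivations \<equiv> D_A3 m"

lemma alpha_nonzero: "p \<in> edges UNIV \<Longrightarrow> \<alpha> p \<noteq> 0"
  using alpha by (cases p) (fastforce simp: edges_def)

lemma alpha_dvd_iff:
  assumes "(i, j) \<in> edges UNIV"
  shows "(X i - X j) ^ m (i, j) dvd p \<longleftrightarrow> \<alpha> (i, j) dvd p"
proof -
  have "(X j - X i) ^ n = (- 1) ^ n * (X i - X j :: 'k S) ^ n" for n
    by (simp flip: power_mult_distrib)
  then have "(X j - X i) ^ n = (X i - X j :: 'k S) ^ n \<or> (X j - X i) ^ n = - ((X i - X j :: 'k S) ^ n)" for n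
    by (cases "even n") simp_all
  then show ?thesis using alpha[OF assms] by (metis minus_dvd_iff)
qed

lemma in_D_A3_iff: "\<theta> \<in> derivations \<longleftrightarrow> (\<forall>i j. (i, j) \<in> edges UNIV \<longrightarrow> \<alpha> (i, j) dvd \<theta> $ i - \<theta> $ j)"
  unfolding D_A3_def by (auto simp: ideal_gen_singleton apply_der_X_diff alpha_dvd_iff)

lemma subspace_D_A3: "svec.subspace derivations"
proof (rule svec.subspaceI)
  fix \<theta> \<eta> assume "\<theta> \<in> derivations" "\<eta> \<in> derivations"
  then have "\<alpha> (i, j) dvd (\<theta> $ i - \<theta> $ j) + (\<eta> $ i - \<eta> $ j)" if "(i, j) \<in> edges UNIV" for i j
    using that unfolding in_D_A3_iff by (intro dvd_add) blast+
  then show "\<theta> + \<eta> \<in> derivations" by (auto simp: in_D_A3_iff algebra_simps)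
next
  fix p \<theta> assume "\<theta> \<in> derivations"
  then show "p *s \<theta> \<in> derivations" by (auto simp: in_D_A3_iff simp flip: right_diff_distrib)
qed (auto simp: in_D_A3_iff)

text \<open>Integration of a cocycle starting at vertex 0: \<open>h $ (0,0)\<close> is the value
  there, and the edges at 0 determine the other values.\<close>

definition derivation_of :: "'k S ^ (4 \<times> 4) \<Rightarrow> 'k S ^ 4"
  where "derivation_of h = (\<chi> i. h $ (0,0) - (if i = 0 then 0 else h $ (0, i) * \<alpha> (0, i)))"

text \<open>The edges at 0 hold by construction, and each of the other three closes a triangle
  through 0.\<close>

lemma derivation_of_diff:
  assumes "h \<in> cocycles" "(i, j) \<in> edges UNIV"
  shows "derivation_of h $ i - derivation_of h $ j = h $ (i, j) * \<alpha> (i, j)"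
proof -
  have "\<forall>k. restrict_triangle k h \<in> tri k" using assms(1) by (simp add: cocycles_def)
  note eqs = this[unfolded restrict_triangle_in_tri_iff]
  have "h $ (1,2) * \<alpha> (1,2) = h $ (0,2) * \<alpha> (0,2) - h $ (0,1) * \<alpha> (0,1)"
    "h $ (1,3) * \<alpha> (1,3) = h $ (0,3) * \<alpha> (0,3) - h $ (0,1) * \<alpha> (0,1)"
    "h $ (2,3) * \<alpha> (2,3) = h $ (0,3) * \<alpha> (0,3) - h $ (0,2) * \<alpha> (0,2)"
    unfolding eq_diff_eq using eqs by (simp_all only: add.commute)
  then show ?thesis using assms(2) unfolding edges_all by (auto simp: derivation_of_def)
qed

lemma bij_derivation_of: "bij_betw derivation_of cocycles derivations"
proof -
  have "inj_on derivation_of cocycles"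
  proof (rule inj_onI)
    fix g h assume gh: "g \<in> cocycles" "h \<in> cocycles" "derivation_of g = derivation_of h"
    have "g $ (i, j) = h $ (i, j)" if "(i, j) \<in> edges UNIV" for i j
      using derivation_of_diff[OF gh(1) that] derivation_of_diff[OF gh(2) that] gh(3) alpha_nonzero[OF that]
      by simp
    moreover have "g $ (0,0) = h $ (0,0)"
      using arg_cong[OF gh(3), of "\<lambda>v. v $ 0"] by (simp add: derivation_of_def)
    moreover have "g $ p = h $ p" if "p \<notin> edges UNIV" "p \<noteq> (0,0)" for p
      using gh(1,2) that unfolding cocycles_def by (metis (mono_tags, lifting) mem_Collect_eq)
    ultimately show "g = h" unfolding vec_eq_iff by (metis surj_pair)
  qed
  moreover have "derivation_of h \<in> derivations" if "h \<in> cocycles" for h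
    using derivation_of_diff[OF that] by (auto simp: in_D_A3_iff)
  moreover have "\<theta> \<in> derivation_of ` cocycles" if "\<theta> \<in> derivations" for \<theta>
  proof -
    have "\<forall>p\<in>edges UNIV. \<exists>g. \<theta> $ fst p - \<theta> $ snd p = g * \<alpha> p"
      using that unfolding in_D_A3_iff dvd_def by (auto simp: mult.commute)
    then obtain g where g: "\<And>p. p \<in> edges UNIV \<Longrightarrow> \<theta> $ fst p - \<theta> $ snd p = g p * \<alpha> p"
      by (auto simp: bchoice_iff)
    define h where "h = (\<chi> p. if p = (0,0) then \<theta> $ 0 else if p \<in> edges UNIV then g p else 0)"
    have "(0,0) \<notin> edges (UNIV :: 4 set)" by (simp add: edges_def)
    then have h: "h $ (i, j) * \<alpha> (i, j) = \<theta> $ i - \<theta> $ j" if "(i, j) \<in> edges UNIV" for i j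
      using g[OF that] that by (auto simp: h_def)
    have h_edges: "h $ (0,1) * \<alpha> (0,1) = \<theta> $ 0 - \<theta> $ 1" "h $ (0,2) * \<alpha> (0,2) = \<theta> $ 0 - \<theta> $ 2"
      "h $ (0,3) * \<alpha> (0,3) = \<theta> $ 0 - \<theta> $ 3" "h $ (1,2) * \<alpha> (1,2) = \<theta> $ 1 - \<theta> $ 2"
      "h $ (1,3) * \<alpha> (1,3) = \<theta> $ 1 - \<theta> $ 3" "h $ (2,3) * \<alpha> (2,3) = \<theta> $ 2 - \<theta> $ 3"
      by (rule h, simp add: edges_all)+
    have "\<forall>k. restrict_triangle k h \<in> tri k"
      unfolding restrict_triangle_in_tri_iff h_edges by simp
    then have "h \<in> cocycles" by (simp add: cocycles_def) (simp add: h_def)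
    moreover have "\<forall>i. derivation_of h $ i = \<theta> $ i"
      unfolding all_4_iff by (simp add: derivation_of_def h_edges) (simp add: h_def)
    then have "\<theta> = derivation_of h" by (simp add: vec_eq_iff)
    ultimately show ?thesis by blast
  qed
  ultimately show ?thesis unfolding bij_betw_def by blast
qed

lemma colon_closed_cocycles_iff: "colon_closed z x y cocycles \<longleftrightarrow> colon_closed z x y derivations"
  by (rule colon_closed_bij[OF subspace_cocycles bij_derivation_of])
    (simp_all add: derivation_of_def vec_eq_iff algebra_simps)

section \<open>Regularity of X 0, x, y, z on the derivations\<close>

lemma D_A3_divide:
  assumes "\<And>i j. (i, j) \<in> edges UNIV \<Longrightarrow> \<exists>q. prime_to (X i - X j) q \<and> q *s \<theta> \<in> derivations"
  shows "\<theta> \<in> derivations"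
  unfolding in_D_A3_iff
proof (intro allI impI)
  fix i j :: 4 assume e: "(i, j) \<in> edges UNIV"
  obtain q where q: "prime_to (X i - X j) q" "q *s \<theta> \<in> derivations" using assms[OF e] by blast
  have "X i - X j \<noteq> (0 :: 'k S)" using e by (auto simp: edges_def)
  \<comment> \<open>Membership is tested on one hyperplane at a time, so \<open>q\<close> may depend
    on the edge.\<close>
  then have "prime_to ((X i - X j) ^ m (i, j)) q" by (rule prime_to_power[OF q(1)])
  moreover have "(X i - X j) ^ m (i, j) dvd q * (\<theta> $ i - \<theta> $ j)"
    using q(2) e unfolding in_D_A3_iff alpha_dvd_iff[OF e] by (auto simp: right_diff_distrib)
  ultimately show "\<alpha> (i, j) dvd \<theta> $ i - \<theta> $ j"
    unfolding alpha_dvd_iff[OF e, symmetric] prime_to_def by blast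
qed

lemma D_A3_divide_X: "X k *s \<theta> \<in> derivations \<Longrightarrow> \<theta> \<in> derivations"
  by (rule D_A3_divide) (auto simp: edges_def intro!: exI[of _ "X k"] prime_to_X_diff_X)

text \<open>Division by \<open>x\<close> can fail only at the hyperplane of \<open>(0,1)\<close>,
  and there \<open>y\<close> is a nonzerodivisor.\<close>

lemma D_A3_divide_x_y:
  assumes "x *s \<theta> \<in> derivations" "y *s \<theta> \<in> derivations"
  shows "\<theta> \<in> derivations"
proof (rule D_A3_divide)
  fix i j :: 4 assume e: "(i, j) \<in> edges UNIV"
  have "prime_to (X i - X j) x \<or> prime_to (X i - X j) y"
  proof (cases "(i, j) = (0,1)")
    case True
    then show ?thesis by (auto simp: subst_simps intro!: disjI2 prime_to_X_diff)
  next
    case False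
    then have "prime_to (X i - X j) x"
      using e unfolding edges_all by (auto simp: subst_simps intro!: prime_to_X_diff)
    then show ?thesis ..
  qed
  then show "\<exists>q. prime_to (X i - X j) q \<and> q *s \<theta> \<in> derivations" using assms by blast
qed

lemma translate_D_A3:
  assumes "\<theta> \<in> derivations"
  shows "subst_vec translate \<theta> \<in> derivations"
  unfolding in_D_A3_iff
proof (intro allI impI)
  fix i j :: 4 assume e: "(i, j) \<in> edges UNIV"
  then obtain g where "\<theta> $ i - \<theta> $ j = \<alpha> (i, j) * g"
    using assms unfolding in_D_A3_iff dvd_def by blast
  from arg_cong[OF this, of "subst translate"]
  have "subst translate (\<theta> $ i) - subst translate (\<theta> $ j) = \<alpha> (i, j) * subst translate g"
    using subst_alpha[OF e, of translate] by (simp add: subst_diff subst_mult translate_def)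
  then show "\<alpha> (i, j) dvd subst_vec translate \<theta> $ i - subst_vec translate \<theta> $ j"
    by (simp add: subst_vec_def)
qed

text \<open>The conditions involve only differences of variables, so they survive restriction to X 0
  = 0, and the remainder can be divided by X 0.\<close>

lemma translate_decompose:
  assumes "\<theta> \<in> derivations"
  obtains \<eta> where "\<eta> \<in> derivations" "\<theta> = subst_vec translate \<theta> + X 0 *s \<eta>"
proof -
  obtain \<eta> where \<eta>: "\<theta> = subst_vec translate \<theta> + X 0 *s \<eta>"
    by (rule subst_vec_decompose[OF dvd_X_diff_translate])
  have "\<theta> - subst_vec translate \<theta> \<in> derivations"
    using assms translate_D_A3 by (intro svec.subspace_diff[OF subspace_D_A3])
  then have "X 0 *s \<eta> \<in> derivations" using \<eta> by (metis add_diff_cancel_left')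
  then show thesis using that \<eta> D_A3_divide_X by blast
qed

lemma subst_vec_translate_xyz:
  "subst_vec translate (x *s v) = x *s subst_vec translate v"
  "subst_vec translate (y *s v) = y *s subst_vec translate v"
  "subst_vec translate (z *s v) = z *s subst_vec translate v"
  "subst_vec translate (X 0 *s v) = 0"
  by (simp_all add: subst_vec_scale subst_translate_X_diff) (simp add: translate_def)

text \<open>For \<open>y\<close> and \<open>z\<close>, \<open>translate\<close> removes the multiple
  of X 0 and fixes \<open>x\<close>, \<open>y\<close>, \<open>z\<close>. Then \<open>y\<close> faces
  a two-term relation, settled by coprimality, and \<open>z\<close> a three-term one, which is
  \<open>cc\<close>.\<close>

lemma regular_rev_D_A3:
  assumes cc: "colon_closed z x y derivations"
  shows "regular_rev [z, y, x, X 0] derivations"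
proof -
  have x: "u \<in> ideal_times [X 0] derivations" if u: "u \<in> derivations" "x *s u \<in> ideal_times [X 0] derivations" for u
  proof -
    obtain v where "x *s u = X 0 *s v" using u(2) by auto
    from prime_to_vec[OF _ _ this] obtain n where "u = X 0 *s n" by (auto simp: prime_to_X)
    then show ?thesis using u(1) D_A3_divide_X by auto
  qed
  have y: "u \<in> ideal_times [x, X 0] derivations" if u: "u \<in> derivations" "y *s u \<in> ideal_times [x, X 0] derivations" for u
  proof -
    obtain v w where "y *s u = x *s v + X 0 *s w" and v: "v \<in> derivations" using u(2) by auto
    from arg_cong[OF this(1), of "subst_vec translate"]
    have "y *s subst_vec translate u = x *s subst_vec translate v"
      by (simp only: subst_vec_add subst_vec_translate_xyz add_0_right)
    from prime_to_vec[OF _ _ this] obtain n where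
      n: "subst_vec translate u = x *s n" "subst_vec translate v = y *s n"
      by (auto simp: prime_to_X_diff_X_diff)
    \<comment> \<open>\<open>x *s n\<close> alone would not suffice, since \<open>x\<close> defines
      a hyperplane of the arrangement; the other half of the relation supplies
      \<open>y *s n\<close>.\<close>
    have "n \<in> derivations"
      by (rule D_A3_divide_x_y[OF translate_D_A3[OF u(1), unfolded n(1)] translate_D_A3[OF v, unfolded n(2)]])
    obtain t where t: "t \<in> derivations" "u = subst_vec translate u + X 0 *s t"
      by (rule translate_decompose[OF u(1)])
    have "u = x *s n + (X 0 *s t + 0)" using t(2) unfolding n(1) by (simp only: add_0_right)
    also have "\<dots> \<in> ideal_times [x, X 0] derivations"
      by (intro ideal_times_ConsI t(1) \<open>n \<in> derivations\<close>) simp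
    finally show ?thesis .
  qed
  have z: "u \<in> ideal_times [y, x, X 0] derivations" if u: "u \<in> derivations" "z *s u \<in> ideal_times [y, x, X 0] derivations" for u
  proof -
    obtain v w r where eq: "z *s u = y *s v + (x *s w + X 0 *s r)" and vw: "v \<in> derivations" "w \<in> derivations"
      using u(2) by auto
    from arg_cong[OF eq, of "subst_vec translate"]
    have "z *s subst_vec translate u = x *s subst_vec translate w + y *s subst_vec translate v"
      by (simp only: subst_vec_add subst_vec_translate_xyz add_0_right) (rule add.commute)
    then obtain v' w' where vw': "v' \<in> derivations" "w' \<in> derivations" and tr: "subst_vec translate u = x *s v' + y *s w'"
      using cc translate_D_A3[OF u(1)] translate_D_A3[OF vw(1)] translate_D_A3[OF vw(2)]
      unfolding colon_closed_def by blast
    obtain t where t: "t \<in> derivations" "u = subst_vec translate u + X 0 *s t"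
      by (rule translate_decompose[OF u(1)])
    have "u = (x *s v' + y *s w') + X 0 *s t" using t(2) unfolding tr .
    also have "\<dots> = y *s w' + (x *s v' + (X 0 *s t + 0))" by (simp only: ac_simps add_0_left)
    also have "\<dots> \<in> ideal_times [y, x, X 0] derivations"
      by (intro ideal_times_ConsI vw' t(1)) simp
    finally show ?thesis .
  qed
  have "u = 0" if "X 0 *s u = 0" for u :: "'k S ^ 4"
    using that by (simp add: vec_eq_iff)
  then show ?thesis
    using x y z unfolding regular_rev.simps by (simp del: ideal_times.simps(2))
qed

lemma hcomp_vec_D_A3:
  assumes "\<theta> \<in> derivations"
  shows "hcomp_vec n \<theta> \<in> derivations"
  unfolding in_D_A3_iff
proof (intro allI impI)
  fix i j :: 4 assume e: "(i, j) \<in> edges UNIV"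
  have hom: "homogeneous (m (i, j)) ((X i - X j) ^ m (i, j))"
    using homogeneous_power[OF homogeneous_diff[OF homogeneous_X homogeneous_X]] by simp
  obtain g where "\<theta> $ i - \<theta> $ j = (X i - X j) ^ m (i, j) * g"
    using assms e alpha_dvd_iff[OF e] unfolding in_D_A3_iff dvd_def by blast
  from arg_cong[OF this, of "hcomp n"]
  have "(X i - X j) ^ m (i, j) dvd hcomp n (\<theta> $ i) - hcomp n (\<theta> $ j)"
    by (simp add: hcomp_diff hcomp_homogeneous_mult[OF hom])
  then show "\<alpha> (i, j) dvd hcomp_vec n \<theta> $ i - hcomp_vec n \<theta> $ j"
    by (simp add: alpha_dvd_iff[OF e] hcomp_vec_def)
qed

lemma X_in_ideal_list: "X i \<in> ideal_list [z, y, x, X 0]"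
proof -
  have "X 0 = z * 0 + (y * 0 + (x * 0 + (X 0 * 1 + 0)))"
    "X 1 = z * 0 + (y * 0 + (x * 1 + (X 0 * 1 + 0)))"
    "X 2 = z * 0 + (y * 1 + (x * 0 + (X 0 * 1 + 0)))"
    "X 3 = z * 1 + (y * 0 + (x * 0 + (X 0 * 1 + 0)))"
    by simp_all
  moreover have "z * p + (y * q + (x * r + (X 0 * s + 0))) \<in> ideal_list [z, y, x, X 0]" for p q r s
    by (intro ideal_list_ConsI) simp
  ultimately have "\<forall>i. X i \<in> ideal_list [z, y, x, X 0]" unfolding all_4_iff by metis
  then show ?thesis by blast
qed

theorem free_iff_generated: "free_submodule derivations \<longleftrightarrow> syzygies_generated_by_triangles \<alpha>"
proof -
  have "free_submodule derivations \<longleftrightarrow> colon_closed z x y derivations"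
  proof
    assume free: "free_submodule derivations"
    have "\<exists>q' r'. p = x * q' + y * r'" if "z * p = x * q + y * r" for p q r
    proof -
      \<comment> \<open>Constant vectors carry the colon condition from \<open>S ^ 4\<close> to the
        ring.\<close>
      have "z *s (\<chi> i::4. p) = x *s (\<chi> i. q) + y *s (\<chi> i. r)" using that by (simp add: vec_eq_iff)
      moreover have "colon_closed z x y (UNIV :: ('k S ^ 4) set)" by (rule colon_closed_UNIV) simp
      ultimately obtain v w :: "'k S ^ 4" where "(\<chi> i::4. p) = x *s v + y *s w"
        unfolding colon_closed_def by blast
      from arg_cong[OF this, of "\<lambda>v. v $ 0"] show ?thesis by auto
    qed
    then show "colon_closed z x y derivations"
      unfolding colon_closed_def using free_submodule_colon[OF subspace_D_A3 free] by blast
  next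
    assume "colon_closed z x y derivations"
    then have reg: "regular_rev [z, y, x, X 0] derivations" by (rule regular_rev_D_A3)
    show "free_submodule derivations"
      by (rule free_if_regular[OF subspace_D_A3 hcomp_vec_D_A3 reg _ X_in_ideal_list])
        (auto intro: homogeneous_diff homogeneous_X[simplified])
  qed
  then show ?thesis
    by (simp add: generated_iff_colon_closed_cocycles colon_closed_cocycles_iff)
qed

end

theorem theorem3p16:
  fixes a b c d e f :: nat
    and x y z :: "'k::field_char_0 S"
    and m :: "4 \<times> 4 \<Rightarrow> nat"
  assumes pos: "0 < a" "0 < b" "0 < c" "0 < d" "0 < e" "0 < f"
    and m: "m = edge_family a b c d e f"
    and x: "x = X 1 - X 0" and y: "y = X 2 - X 0" and z: "z = X 3 - X 0"
  shows "(free_submodule (D_A3 m :: ('k S ^ 4) set) \<longleftrightarrow>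
            syzygies_generated_by_triangles (\<lambda>(i, j). (X i - X j :: 'k S) ^ m (i, j))) \<and>
         (free_submodule (D_A3 m :: ('k S ^ 4) set) \<longleftrightarrow>
            syzygies_generated_by_triangles
              (edge_family (x ^ a) (y ^ b) (z ^ c) ((y - x) ^ d) ((z - x) ^ e) ((z - y) ^ f)))"
proof
  show "free_submodule (D_A3 m :: ('k S ^ 4) set) \<longleftrightarrow>
      syzygies_generated_by_triangles (\<lambda>(i, j). (X i - X j :: 'k S) ^ m (i, j))"
    by (rule braid_powers.free_iff_generated) (unfold_locales, simp)
  \<comment> \<open>Here every edge takes the second sign in \<open>alpha\<close>, as the forms
    subtract the variable of the smaller vertex.\<close>
  show "free_submodule (D_A3 m :: ('k S ^ 4) set) \<longleftrightarrow>
      syzygies_generated_by_triangles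
        (edge_family (x ^ a) (y ^ b) (z ^ c) ((y - x) ^ d) ((z - x) ^ e) ((z - y) ^ f))"
    by (rule braid_powers.free_iff_generated, unfold_locales) (auto simp: edges_all m x y z)
qed

end
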